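(* Let $p>1$, let $\mathcal{F}$ be a foliation on a Riemannian manifold $M$, and assume there is an extremal function $f_0$ for the $p$-modulus of $\mathcal{F}$. Then $$\int_M f_0^{p-1}\varphi\,\hat\psi\,d\bar\mu=\int_M f_0^{p-1}\hat\varphi\,\psi\,d\bar\mu=\int_M f_0^p\,\hat\varphi\,\hat\psi\,d\bar\mu$$ for any $\varphi,\psi\in L^p(\mathcal{F})$. In particular, $$\int_M f_0^{p-1}\varphi\,d\bar\mu=\int_M f_0^p\,\hat\varphi\,d\bar\mu,\qquad \varphi\in L^p(\mathcal{F}).$$
   Context: $\bar\mu$ is the Riemannian (Lebesgue) measure on $M$ and $\mu_L$ the Riemannian measure on a leaf $L$ of the $k$-dimensional foliation $\mathcal{F}$. A nonnegative Borel function $f$ on $M$ is admissible for $\mathcal{F}$ if $\int_L f\,d\mu_L\ge 1$ for all $L\in\mathcal{F}$; $\mathrm{mod}_p(\mathcal{F})=\inf\int_M f^p\,d\bar\mu$ over admissible $f$ ($=\infty$ if there are none). An admissible function $f_0$ with $\mathrm{mod}_p(\mathcal{F})=\int_M f_0^p\,d\bar\mu$ is called the extremal function for the $p$-modulus of $\mathcal{F}$. For $\varphi\in L^p(M)$, $\hat\varphi(x)=\int_{L_x}\varphi\,d\mu_{L_x}$, where $L_x$ is the leaf through $x$ (defined almost everywhere when an extremal function exists). $L^p(\mathcal{F})=\{\varphi\in L^p(M):\mathrm{ess\,sup}|\hat\varphi|<\infty\}$.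
   Formalization: The p-modulus of the foliation is assumed finite as part of having an extremal function; if it is infinite, every admissible function would be extremal and the identities fail, e.g. for the circles in R×S^1. *)

theory Defs
  imports "HOL-Analysis.Analysis" "HOL-Probability.Essential_Supremum"
    "HOL-Combinatorics.Permutations"
begin

subsection \<open>Smooth manifolds\<close>

primrec Ck_on :: "nat \<Rightarrow> 'a::real_normed_vector set \<Rightarrow> ('a \<Rightarrow> 'b::real_normed_vector) \<Rightarrow> bool" where
  "Ck_on 0 S f \<longleftrightarrow> continuous_on S f"
| "Ck_on (Suc k) S f \<longleftrightarrow>
     (\<forall>x\<in>S. f differentiable (at x)) \<and> (\<forall>v. Ck_on k S (\<lambda>x. frechet_derivative f (at x) v))"

definition smooth_on :: "'a::real_normed_vector set \<Rightarrow> ('a \<Rightarrow> 'b::real_normed_vector) \<Rightarrow> bool" where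
  "smooth_on S f \<longleftrightarrow> (\<forall>k. Ck_on k S f)"

text \<open>
  The manifold is the whole type \<open>'m\<close>, modelled on the Euclidean space \<open>'e\<close>. A chart is a pair of
  a domain and a map; the values of the map outside the domain are irrelevant.
\<close>

type_synonym ('m, 'e) chart = "'m set \<times> ('m \<Rightarrow> 'e)"

definition is_chart :: "('m::topological_space, 'e::euclidean_space) chart \<Rightarrow> bool" where
  "is_chart c \<longleftrightarrow> open (fst c) \<and> open (snd c ` fst c) \<and>
     homeomorphism (fst c) (snd c ` fst c) (snd c) (inv_into (fst c) (snd c))"

definition transition ::
    "('m, 'e::euclidean_space) chart \<Rightarrow> ('m, 'e) chart \<Rightarrow> 'e \<Rightarrow> 'e" where
  "transition c c' = snd c' \<circ> inv_into (fst c) (snd c)"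

definition smooth_atlas :: "('m::topological_space, 'e::euclidean_space) chart set \<Rightarrow> bool" where
  "smooth_atlas A \<longleftrightarrow>
     (\<forall>c\<in>A. is_chart c) \<and> (\<Union>c\<in>A. fst c) = UNIV \<and>
     (\<forall>c\<in>A. \<forall>c'\<in>A. smooth_on (snd c ` (fst c \<inter> fst c')) (transition c c'))"

subsection \<open>Riemannian metrics and the Riemannian measure\<close>

text \<open>
  A Riemannian metric is given by its local representatives: \<open>g c x\<close> is the inner product, in the
  coordinates of the chart \<open>c\<close>, at the point with coordinates \<open>x\<close>. The last clause is the
  transformation law of a covariant 2-tensor.
\<close>

definition riemannian_metric ::
    "('m, 'e::euclidean_space) chart set \<Rightarrow> (('m, 'e) chart \<Rightarrow> 'e \<Rightarrow> 'e \<Rightarrow> 'e \<Rightarrow> real) \<Rightarrow> bool" where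
  "riemannian_metric A g \<longleftrightarrow>
     (\<forall>c\<in>A. \<forall>x \<in> snd c ` fst c.
        bilinear (g c x) \<and> (\<forall>u v. g c x u v = g c x v u) \<and> (\<forall>u. u \<noteq> 0 \<longrightarrow> g c x u u > 0)) \<and>
     (\<forall>c\<in>A. \<forall>u v. smooth_on (snd c ` fst c) (\<lambda>x. g c x u v)) \<and>
     (\<forall>c\<in>A. \<forall>c'\<in>A. \<forall>x \<in> snd c ` (fst c \<inter> fst c'). \<forall>u v.
        g c x u v = g c' (transition c c' x)
          (frechet_derivative (transition c c') (at x) u)
          (frechet_derivative (transition c c') (at x) v))"

text \<open>
  The determinant (Leibniz formula) of the Gram matrix of the bilinear form \<open>b\<close> on the vectors of
  \<open>D\<close>. The library determinant is not used because \<open>D\<close> will be an arbitrary subset of the basis.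
\<close>

definition gram_det :: "'e set \<Rightarrow> ('e \<Rightarrow> 'e \<Rightarrow> real) \<Rightarrow> real" where
  "gram_det D b = (\<Sum>p | p permutes D. of_int (sign p) * (\<Prod>i\<in>D. b i (p i)))"

text \<open>
  \<open>vol\<close> is the Riemannian measure of \<open>g\<close> on the Borel sets: the unique Borel measure that in every
  chart is \<open>sqrt (det g)\<close> times Lebesgue measure.
\<close>

definition riemannian_measure ::
    "('m::topological_space, 'e::euclidean_space) chart set \<Rightarrow>
     (('m, 'e) chart \<Rightarrow> 'e \<Rightarrow> 'e \<Rightarrow> 'e \<Rightarrow> real) \<Rightarrow> 'm measure \<Rightarrow> bool" where
  "riemannian_measure A g vol \<longleftrightarrow>
     sets vol = sets borel \<and>
     (\<forall>c\<in>A. \<forall>B\<in>sets borel. B \<subseteq> fst c \<longrightarrow>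
        emeasure vol B =
          (\<integral>\<^sup>+ x. indicator (snd c ` B) x * ennreal (sqrt (gram_det Basis (g c x))) \<partial>lborel))"

subsection \<open>Foliations\<close>

text \<open>
  For \<open>D \<subseteq> Basis\<close> the leaf directions in the model space are those in \<open>span D\<close>, so the leaves have
  dimension \<open>card D\<close> (the extreme cases \<open>D = {}\<close> and \<open>D = Basis\<close> are allowed).
\<close>

definition transverse :: "'e::euclidean_space set \<Rightarrow> 'e \<Rightarrow> 'e" where
  "transverse D x = (\<Sum>b\<in>Basis - D. (x \<bullet> b) *\<^sub>R b)"

text \<open>
  A foliation of the manifold with smooth atlas \<open>A\<close> is a subatlas \<open>F\<close> of charts whose transition maps
  locally have the form \<open>(x, y) \<mapsto> (h1 (x, y), h2 y)\<close>, where \<open>y\<close> is the transverse coordinate.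
  The atlas \<open>A\<close> need not be maximal, but may be.
\<close>

definition foliation ::
    "('m::topological_space, 'e::euclidean_space) chart set \<Rightarrow> 'e set \<Rightarrow> ('m, 'e) chart set \<Rightarrow> bool" where
  "foliation A D F \<longleftrightarrow>
     D \<subseteq> Basis \<and> F \<subseteq> A \<and> (\<Union>c\<in>F. fst c) = UNIV \<and>
     (\<forall>c\<in>F. \<forall>c'\<in>F. \<forall>x \<in> fst c \<inter> fst c'. \<exists>N. open N \<and> x \<in> N \<and> N \<subseteq> fst c \<inter> fst c' \<and>
        (\<forall>y\<in>N. \<forall>z\<in>N. transverse D (snd c y) = transverse D (snd c z) \<longrightarrow>
           transverse D (snd c' y) = transverse D (snd c' z)))"

definition plaque ::
    "'e::euclidean_space set \<Rightarrow> ('m::topological_space, 'e) chart \<Rightarrow> 'm \<Rightarrow> 'm set" where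
  "plaque D c x =
     connected_component_set {z \<in> fst c. transverse D (snd c z) = transverse D (snd c x)} x"

definition leaf ::
    "'e::euclidean_space set \<Rightarrow> ('m::topological_space, 'e) chart set \<Rightarrow> 'm \<Rightarrow> 'm set" where
  "leaf D F x = {y. (\<lambda>u v. \<exists>c\<in>F. u \<in> fst c \<and> v \<in> plaque D c u)\<^sup>*\<^sup>* x y}"

definition leaves ::
    "'e::euclidean_space set \<Rightarrow> ('m::topological_space, 'e) chart set \<Rightarrow> 'm set set" where
  "leaves D F = range (leaf D F)"

text \<open>Lebesgue measure of the coordinate subspace \<open>span D\<close>, as a measure on the model space.\<close>

definition lborel_span :: "'e::euclidean_space set \<Rightarrow> 'e measure" where
  "lborel_span D = distr (\<Pi>\<^sub>M b\<in>D. (lborel :: real measure)) borel (\<lambda>s. \<Sum>b\<in>D. s b *\<^sub>R b)"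

lemma lborel_span_Basis: "lborel_span Basis = lborel"
  unfolding lborel_span_def lborel_eq_real lborel_def[where 'a='a] by simp

text \<open>
  \<open>\<nu>\<close> is the Riemannian measure of the leaf \<open>L\<close> with the induced metric: on each plaque it is
  \<open>sqrt (det (g restricted to the leaf directions))\<close> times Lebesgue measure of the leaf coordinates.
  On a leaf of a second-countable manifold the Borel sets of the leaf topology are the traces on \<open>L\<close>
  of the Borel sets of the manifold, because \<open>L\<close> is a countable union of plaques, on which the two
  topologies agree and which are Borel sets of the manifold.
\<close>

definition leaf_riemannian_measure ::
    "'e::euclidean_space set \<Rightarrow> ('m::topological_space, 'e) chart set \<Rightarrow>
     (('m, 'e) chart \<Rightarrow> 'e \<Rightarrow> 'e \<Rightarrow> 'e \<Rightarrow> real) \<Rightarrow> 'm set \<Rightarrow> 'm measure \<Rightarrow> bool" where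
  "leaf_riemannian_measure D F g L \<nu> \<longleftrightarrow>
     space \<nu> = L \<and> sets \<nu> = sets (restrict_space borel L) \<and>
     (\<forall>c\<in>F. \<forall>x \<in> fst c \<inter> L. \<forall>B\<in>sets borel. B \<subseteq> plaque D c x \<longrightarrow>
        emeasure \<nu> B =
          (\<integral>\<^sup>+ s. indicator (snd c ` B) (transverse D (snd c x) + s) *
             ennreal (sqrt (gram_det D (g c (transverse D (snd c x) + s)))) \<partial>lborel_span D))"

subsection \<open>The modulus of a foliation\<close>

text \<open>
  From here on only the set \<open>\<L>\<close> of leaves (a partition of \<open>'m\<close>), the measure \<open>vol\<close> and the
  measures \<open>\<mu> L\<close> on the leaves matter.
\<close>

definition admissible ::
    "'m::topological_space set set \<Rightarrow> ('m set \<Rightarrow> 'm measure) \<Rightarrow> ('m \<Rightarrow> real) \<Rightarrow> bool" where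
  "admissible \<L> \<mu> f \<longleftrightarrow>
     f \<in> borel_measurable borel \<and> (\<forall>x. 0 \<le> f x) \<and> (\<forall>L\<in>\<L>. (\<integral>\<^sup>+ y. ennreal (f y) \<partial>\<mu> L) \<ge> 1)"

definition modulus ::
    "'m::topological_space set set \<Rightarrow> 'm measure \<Rightarrow> ('m set \<Rightarrow> 'm measure) \<Rightarrow> real \<Rightarrow> ennreal" where
  "modulus \<L> vol \<mu> p = (INF f\<in>{f. admissible \<L> \<mu> f}. (\<integral>\<^sup>+ x. ennreal (f x powr p) \<partial>vol))"

text \<open>
  An extremal function is an element of \<open>L\<^sup>p\<close>, i.e. the modulus is finite: otherwise, when
  all admissible functions have infinite \<open>p\<close>-norm, every one of them would be extremal.
\<close>

definition extremal ::
    "'m::topological_space set set \<Rightarrow> 'm measure \<Rightarrow> ('m set \<Rightarrow> 'm measure) \<Rightarrow> real \<Rightarrow> ('m \<Rightarrow> real) \<Rightarrow> bool"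
  where
  "extremal \<L> vol \<mu> p f0 \<longleftrightarrow> admissible \<L> \<mu> f0 \<and>
     modulus \<L> vol \<mu> p = (\<integral>\<^sup>+ x. ennreal (f0 x powr p) \<partial>vol) \<and> modulus \<L> vol \<mu> p < \<infinity>"

text \<open>
  \<open>hat lf \<mu> \<phi> x\<close>, for \<open>lf x\<close> the leaf through \<open>x\<close>. The completion makes sense of Lebesgue
  measurable \<open>\<phi>\<close>. On leaves where \<open>\<phi>\<close> is not integrable, the value is the conventional 0.
\<close>

definition hat ::
    "('m \<Rightarrow> 'm set) \<Rightarrow> ('m set \<Rightarrow> 'm measure) \<Rightarrow> ('m \<Rightarrow> real) \<Rightarrow> 'm \<Rightarrow> real" where
  "hat lf \<mu> \<phi> x = (\<integral>y. \<phi> y \<partial>completion (\<mu> (lf x)))"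

definition Lp_space :: "'m measure \<Rightarrow> real \<Rightarrow> ('m \<Rightarrow> real) set" where
  "Lp_space M p = {\<phi>. \<phi> \<in> borel_measurable M \<and> integrable M (\<lambda>x. \<bar>\<phi> x\<bar> powr p)}"

definition Lp_foliation ::
    "('m \<Rightarrow> 'm set) \<Rightarrow> 'm measure \<Rightarrow> ('m set \<Rightarrow> 'm measure) \<Rightarrow> real \<Rightarrow> ('m \<Rightarrow> real) set" where
  "Lp_foliation lf vol \<mu> p =
     {\<phi> \<in> Lp_space (completion vol) p.
        esssup (completion vol) (\<lambda>x. ereal \<bar>hat lf \<mu> \<phi> x\<bar>) < \<infinity>}"

end

theory Submission
  imports Defs
begin

text \<open>
  The leafwise integral of a nonnegative Borel function is a Borel function on the manifold: sliding
  along the slices of countably many flow boxes to countably many leaf coordinates reaches every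
  slice of the leaf of \<open>x\<close> by a countable family of Borel maps, so a leafwise integral is a
  countable sum of integrals over slices, each depending measurably on \<open>x\<close>.

  Given this, \<open>f0\<close> may be replaced by another function on any Borel union of leaves. Such
  replacements show that, almost everywhere where \<open>f0\<close> does not vanish, the integral of \<open>f0\<close> over
  the leaf is 1, functions in \<open>L\<^sup>p\<close> are integrable on the leaf, and null sets are null on the leaf;
  no Fubini theorem for the foliation is needed. The competitors \<open>(f0 + t (\<phi> - f0 hat \<phi>))\<^sup>+\<close>, as
  \<open>t\<close> tends to 0, for \<open>\<phi>\<close> multiplied by functions that are constant on leaves, and the same for
  \<open>- \<phi>\<close>, then give the identities.
\<close>

subsection \<open>Leaves and flow boxes\<close>

text \<open>Every integrand in the statement carries a positive power of \<open>f0\<close>, so facts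
  about leaves matter only at points where \<open>f0\<close> does not vanish. This is what makes
  minimality sufficient: if a union of leaves admits an arbitrarily cheap replacement for
  \<open>f0\<close>, then \<open>f0\<close> vanishes on it almost everywhere. Minimality is thus the
  link between null sets of the manifold and null sets of leaves. The price is that the unions of
  leaves have to be Borel. Here the obstacle is that a leaf may return to a box infinitely often and
  accumulate on itself, so its slices must be enumerated by Borel functions of the point. The
  perturbation \<phi> - f0 hat \<phi> has leafwise integral 0 where \<open>f0\<close> has leafwise
  integral 1, so adding it keeps the constraint exactly, and the positive part can only raise
  leafwise integrals. Since hat (\<xi> \<phi>) = \<xi> hat \<phi> for \<xi> constant on leaves,
  taking \<xi> = hat \<psi> produces an expression symmetric in \<phi> and \<psi>, which is the
  source of the double identity.\<close>

lemma transverse_add: "transverse D (x + y) = transverse D x + transverse D y"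
  by (simp add: transverse_def inner_add_left scaleR_add_left sum.distrib)

lemma transverse_diff: "transverse D (x - y) = transverse D x - transverse D y"
  by (simp add: transverse_def inner_diff_left scaleR_diff_left sum_subtractf)

lemma transverse_scaleR: "transverse D (r *\<^sub>R x) = r *\<^sub>R transverse D x"
  by (simp add: transverse_def scaleR_sum_right)

lemma transverse_inner:
  assumes "b \<in> Basis" shows "transverse D x \<bullet> b = (if b \<in> D then 0 else x \<bullet> b)"
proof -
  have "transverse D x \<bullet> b = (\<Sum>c\<in>Basis - D. if c = b then x \<bullet> b else 0)"
    unfolding transverse_def inner_sum_left using assms
    by (intro sum.cong) (auto simp: inner_Basis)
  then show ?thesis using assms by (simp add: sum.delta)
qed

lemma transverse_transverse [simp]: "transverse D (transverse D x) = transverse D x"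
  by (rule euclidean_eqI) (simp add: transverse_inner)

lemma continuous_on_transverse: "continuous_on S (transverse D)"
  unfolding transverse_def by (intro continuous_intros)

lemma transverse_leaf_direction:
  assumes "D \<subseteq> Basis"
  shows "transverse D (\<Sum>b\<in>D. s b *\<^sub>R b) = 0"
proof -
  have "(\<Sum>b\<in>D. s b *\<^sub>R b) \<bullet> c = 0" if "c \<in> Basis - D" for c
    unfolding inner_sum_left
    using that assms by (intro sum.neutral ballI) (metis Diff_iff inner_not_same_Basis inner_scaleR_left
        mult_zero_right subsetD)
  then show ?thesis
    unfolding transverse_def by (intro sum.neutral) simp
qed

lemma plaque_eq:
  assumes "y \<in> plaque D c x"
  shows "y \<in> fst c" "transverse D (snd c y) = transverse D (snd c x)" "plaque D c y = plaque D c x"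
proof -
  let ?S = "\<lambda>x. {z \<in> fst c. transverse D (snd c z) = transverse D (snd c x)}"
  have y: "y \<in> ?S x"
    using assms unfolding plaque_def using connected_component_subset by blast
  then show "y \<in> fst c" "transverse D (snd c y) = transverse D (snd c x)"
    by auto
  then have "?S y = ?S x" by auto
  then show "plaque D c y = plaque D c x"
    using assms connected_component_eq unfolding plaque_def by metis
qed

lemma self_in_plaque: "x \<in> fst c \<Longrightarrow> x \<in> plaque D c x"
  by (simp add: plaque_def connected_component_refl)

lemma self_in_leaf: "x \<in> leaf D F x"
  by (simp add: leaf_def)

lemma plaque_subset_leaf: "c \<in> F \<Longrightarrow> u \<in> fst c \<Longrightarrow> plaque D c u \<subseteq> leaf D F u"
  unfolding leaf_def by (auto intro!: r_into_rtranclp)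

lemma leaf_trans: "y \<in> leaf D F x \<Longrightarrow> z \<in> leaf D F y \<Longrightarrow> z \<in> leaf D F x"
  unfolding leaf_def by auto

text \<open>All points of a plaque have the same plaque in that chart, so the relation generating
  the leaves is symmetric and leaves form a partition.\<close>

lemma leaf_sym: 
  assumes "y \<in> leaf D F x" shows "x \<in> leaf D F y"
proof -
  let ?r = "\<lambda>u v. \<exists>c\<in>F. u \<in> fst c \<and> v \<in> plaque D c u"
  have "symp ?r"
    by (intro sympI) (metis plaque_eq(1,3) self_in_plaque)
  from symp_rtranclp[OF this] assms show ?thesis
    unfolding leaf_def by (auto dest: sympD)
qed

lemma leaf_eq: "y \<in> leaf D F x \<Longrightarrow> leaf D F y = leaf D F x"
  by (intro equalityI subsetI) (auto intro: leaf_sym leaf_trans)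

section \<open>Flow boxes and their slices\<close>

locale flow_boxes =
  fixes F :: "('m::{second_countable_topology, t2_space}, 'e::euclidean_space) chart set"
    and D :: "'e set"
    and C :: "nat \<Rightarrow> ('m, 'e) chart" and Q :: "nat \<Rightarrow> 'e set"
  assumes chart: "c \<in> F \<Longrightarrow> is_chart c"
    and D: "D \<subseteq> Basis"
    and compatible: "c \<in> F \<Longrightarrow> c' \<in> F \<Longrightarrow> x \<in> fst c \<Longrightarrow> x \<in> fst c' \<Longrightarrow>
      \<exists>N. open N \<and> x \<in> N \<and> N \<subseteq> fst c \<inter> fst c' \<and>
        (\<forall>y\<in>N. \<forall>z\<in>N. transverse D (snd c y) = transverse D (snd c z) \<longrightarrow>
           transverse D (snd c' y) = transverse D (snd c' z))"
    and C: "C i \<in> F" and open_Q: "open (Q i)" and convex_Q: "convex (Q i)"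
    and Q_subset: "Q i \<subseteq> snd (C i) ` fst (C i)"
    and cover: "\<exists>i. x \<in> fst (C i) \<and> snd (C i) x \<in> Q i"
begin

definition U :: "nat \<Rightarrow> 'm set" where
  "U i = {x \<in> fst (C i). snd (C i) x \<in> Q i}"

definition point :: "nat \<Rightarrow> 'e \<Rightarrow> 'm" where
  "point i = inv_into (fst (C i)) (snd (C i))"

definition height :: "nat \<Rightarrow> 'm \<Rightarrow> 'e" where
  "height i x = transverse D (snd (C i) x)"

definition slice :: "nat \<Rightarrow> 'm \<Rightarrow> 'm set" where
  "slice i x = {y \<in> U i. height i y = height i x}"

lemma homeo: "homeomorphism (fst (C i)) (snd (C i) ` fst (C i)) (snd (C i)) (point i)"
  and open_dom: "open (fst (C i))"
  using chart[OF C[of i]] by (auto simp: is_chart_def point_def)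

lemma point_chart: "x \<in> U i \<Longrightarrow> point i (snd (C i) x) = x"
  using homeo[of i] by (auto simp: U_def homeomorphism_def)

lemma point_in_U: "e \<in> Q i \<Longrightarrow> point i e \<in> U i"
  and chart_point: "e \<in> Q i \<Longrightarrow> snd (C i) (point i e) = e"
  using homeo[of i] Q_subset[of i] by (auto simp: U_def homeomorphism_def)

lemma chart_in_Q: "x \<in> U i \<Longrightarrow> snd (C i) x \<in> Q i"
  by (simp add: U_def)

lemma continuous_chart: "continuous_on (U i) (snd (C i))"
  using homeo[of i] by (auto simp: U_def homeomorphism_def intro: continuous_on_subset)

lemma continuous_point: "continuous_on (Q i) (point i)"
  using homeo[of i] Q_subset[of i] by (auto simp: homeomorphism_def intro: continuous_on_subset)

lemma open_U: "open (U i)"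
proof -
  have "U i = fst (C i) \<inter> snd (C i) -` Q i" by (auto simp: U_def)
  then show ?thesis
    using continuous_open_preimage[of "fst (C i)" "snd (C i)" "Q i"] homeo[of i] open_dom open_Q
    by (auto simp: homeomorphism_def)
qed

lemma slice_eq: "y \<in> slice i x \<Longrightarrow> slice i y = slice i x"
  by (auto simp: slice_def)

text \<open>A convex set cut by an affine subspace is convex, so the slice is a continuous image of
  a connected set. This is why \<open>Q i\<close> is required to be convex: a slice never spreads
  over several plaques.\<close>

lemma slice_subset_plaque:
  assumes "x \<in> U i" shows "slice i x \<subseteq> plaque D (C i) x"
  unfolding plaque_def
proof (rule connected_component_maximal)
  show "x \<in> slice i x" using assms by (simp add: slice_def)
  have "slice i x = point i ` (Q i \<inter> {e. transverse D e = height i x})"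
  proof (intro equalityI subsetI)
    fix y assume "y \<in> slice i x"
    then show "y \<in> point i ` (Q i \<inter> {e. transverse D e = height i x})"
      by (intro image_eqI[of _ _ "snd (C i) y"])
        (auto simp: slice_def point_chart chart_in_Q height_def)
  qed (auto simp: slice_def point_in_U chart_point height_def)
  moreover have "convex (Q i \<inter> {e. transverse D e = height i x})"
    by (intro convex_Int convex_Q) (auto simp: convex_def transverse_add transverse_scaleR
        simp flip: scaleR_add_left)
  ultimately show "connected (slice i x)"
    by (auto intro!: connected_continuous_image convex_connected
        intro: continuous_on_subset[OF continuous_point])
  show "slice i x \<subseteq> {z \<in> fst (C i). transverse D (snd (C i) z) = transverse D (snd (C i) x)}"
    by (auto simp: slice_def U_def height_def)
qed

lemma slice_subset_leaf: "x \<in> U i \<Longrightarrow> slice i x \<subseteq> leaf D F x"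
  using slice_subset_plaque plaque_subset_leaf[OF C] by (fastforce simp: U_def)

lemma compatible_flow_box:
  assumes "c \<in> F" "x \<in> fst c" "x \<in> U j"
  obtains N where "open N" "x \<in> N" "N \<subseteq> fst c \<inter> U j"
    "\<And>y z. y \<in> N \<Longrightarrow> z \<in> N \<Longrightarrow> transverse D (snd c y) = transverse D (snd c z) \<Longrightarrow>
      height j y = height j z"
proof -
  obtain N where N: "open N" "x \<in> N" "N \<subseteq> fst c \<inter> fst (C j)"
    "\<forall>y\<in>N. \<forall>z\<in>N. transverse D (snd c y) = transverse D (snd c z) \<longrightarrow>
       transverse D (snd (C j) y) = transverse D (snd (C j) z)"
    using compatible[of c "C j" x] assms C by (auto simp: U_def)
  with assms open_U[of j] show thesis
    by (intro that[of "N \<inter> U j"]) (auto simp: height_def)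
qed

text \<open>Only the component of \<open>d\<close> along the leaves matters.\<close>

definition slide :: "nat \<Rightarrow> 'e \<Rightarrow> 'm \<Rightarrow> 'm" where
  "slide i d x = (let e = height i x + (d - transverse D d) in
     if x \<in> U i \<and> e \<in> Q i then point i e else x)"

lemma slide_cases:
  obtains "slide i d x = x" | "x \<in> U i" "slide i d x \<in> slice i x"
proof (cases "x \<in> U i \<and> height i x + (d - transverse D d) \<in> Q i")
  case True
  then have "slide i d x \<in> slice i x"
    by (auto simp: slide_def Let_def slice_def point_in_U height_def chart_point
        transverse_add transverse_diff)
  with True that show ?thesis by blast
qed (use that in \<open>auto simp: slide_def Let_def\<close>)

lemma slide_in_leaf: "slide i d x \<in> leaf D F x"
  proof (rule slide_cases[of i d x])
  assume "x \<in> U i" "slide i d x \<in> slice i x"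
  then show ?thesis using slice_subset_leaf by blast
qed (simp add: self_in_leaf)

section \<open>Countably many walks exhausting a leaf\<close>

definition dense_seq :: "nat \<Rightarrow> 'e" where
  "dense_seq = (SOME f. \<forall>X. open X \<longrightarrow> X \<noteq> {} \<longrightarrow> (\<exists>n. f n \<in> X))"

lemma dense_seq:
  assumes "open X" "X \<noteq> {}" shows "\<exists>n. dense_seq n \<in> X"
proof -
  obtain E :: "'e set" where E: "countable E" "\<And>X. open X \<Longrightarrow> X \<noteq> {} \<Longrightarrow> \<exists>d \<in> E. d \<in> X"
    by (rule countable_dense_setE) blast
  then have "E \<noteq> {}" using E(2)[of UNIV] by auto
  then have "range (from_nat_into E) = E" using E(1) by (rule range_from_nat_into)
  then have "\<exists>f :: nat \<Rightarrow> 'e. \<forall>X. open X \<longrightarrow> X \<noteq> {} \<longrightarrow> (\<exists>n. f n \<in> X)"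
    using E(2) by (intro exI[of _ "from_nat_into E"]) (metis imageE)
  from someI_ex[OF this] assms show ?thesis unfolding dense_seq_def by blast
qed

text \<open>Instructions are lists of pairs of numbers, so there are countably many, the same for
  all starting points. An instruction that cannot be carried out leaves the point where it is, which
  makes every walk a total map.\<close>

definition walk :: "(nat \<times> nat) list \<Rightarrow> 'm \<Rightarrow> 'm" where
  "walk ws = fold (\<lambda>(i, n). slide i (dense_seq n)) ws"

lemma walk_Nil [simp]: "walk [] x = x"
  and walk_snoc [simp]: "walk (ws @ [(i, n)]) x = slide i (dense_seq n) (walk ws x)"
  by (simp_all add: walk_def)

lemma walk_in_leaf: "walk ws x \<in> leaf D F x"
proof (induction ws rule: rev_induct)
  case (snoc w ws)
  then show ?case
    by (cases w) (auto intro: leaf_trans slide_in_leaf)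
qed (simp add: self_in_leaf)

text \<open>The slice through \<open>y\<close> has to be hit in every box containing
  \<open>y\<close>, not just in one. In this form the property passes to overlapping boxes and
  propagates along plaques.\<close>

definition reach :: "'m \<Rightarrow> 'm set" where
  "reach x = {y. \<forall>i. y \<in> U i \<longrightarrow> (\<exists>ws. walk ws x \<in> slice i y)}"

text \<open>A walk that hits the slice of \<open>z\<close> in box \<open>j\<close> is extended by
  one slide within that slice to a point so close to \<open>z\<close> that compatibility of the
  charts puts it into the slice of \<open>z\<close> in box \<open>i\<close>. Density of the leaf
  coordinates provides the slide.\<close>

lemma reach_slice:
  assumes "y \<in> reach x" "y \<in> U j" "z \<in> slice j y"
  shows "z \<in> reach x"
  unfolding reach_def
proof (intro CollectI allI impI)
  fix i assume i: "z \<in> U i"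
  obtain ws where ws: "walk ws x \<in> slice j z"
    using assms slice_eq by (auto simp: reach_def)
  have z: "z \<in> U j" using assms by (simp add: slice_def)
  then have "z \<in> fst (C j)" by (simp add: U_def)
  then obtain N where N: "open N" "z \<in> N" "N \<subseteq> fst (C j) \<inter> U i"
    and compat: "\<And>u v. u \<in> N \<Longrightarrow> v \<in> N \<Longrightarrow> height j u = height j v \<Longrightarrow> height i u = height i v"
    using i compatible_flow_box[OF C, of z j i] unfolding height_def by metis
  define V where "V = {e \<in> Q j. point j e \<in> N}"
  have V: "open V"
  proof -
    have "V = Q j \<inter> point j -` N" by (auto simp: V_def)
    then show ?thesis using continuous_open_preimage[OF continuous_point open_Q N(1)] by simp
  qed
  \<comment> \<open>The map replaces the transverse part of \<open>e\<close> by the height of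
    \<open>z\<close>. The preimage of \<open>V\<close> is open in the whole model space, so a dense
    sequence of that space meets it.\<close>
  have "open ((\<lambda>e. height j z + (e - transverse D e)) -` V)"
    by (intro open_vimage V continuous_intros continuous_on_transverse)
  moreover have "snd (C j) z \<in> (\<lambda>e. height j z + (e - transverse D e)) -` V"
    using z N by (simp add: height_def V_def point_chart chart_in_Q)
  ultimately obtain n where n: "height j z + (dense_seq n - transverse D (dense_seq n)) \<in> V"
    using dense_seq by blast
  let ?e = "height j z + (dense_seq n - transverse D (dense_seq n))"
  have "slide j (dense_seq n) (walk ws x) = point j ?e"
    using ws n by (auto simp: slide_def slice_def V_def)
  moreover have "height j (point j ?e) = height j z"
    using n by (simp add: V_def height_def chart_point transverse_add transverse_diff)
  with n have "point j ?e \<in> slice i z"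
    using compat[of "point j ?e" z] N by (auto simp: slice_def V_def)
  ultimately show "\<exists>ws. walk ws x \<in> slice i z"
    by (intro exI[of _ "ws @ [(j, n)]"]) simp
qed

text \<open>A plaque of an arbitrary foliation chart may cross many boxes, but near each of its
  points it lies in one slice of a box. Hence membership in \<open>reach x\<close> is locally
  constant along the plaque, which is connected.\<close>

lemma reach_plaque:
  assumes c: "c \<in> F" and u: "u \<in> fst c" "u \<in> reach x" and v: "v \<in> plaque D c u"
  shows "v \<in> reach x"
proof -
  have "u \<in> reach x \<longleftrightarrow> v \<in> reach x"
  proof (rule connected_equivalence_relation[where S = "plaque D c u" and
        R = "\<lambda>a b. a \<in> reach x \<longleftrightarrow> b \<in> reach x"])
    show "connected (plaque D c u)" by (simp add: plaque_def)
    show "u \<in> plaque D c u" "v \<in> plaque D c u" using v self_in_plaque[OF u(1)] by auto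
    fix z assume z: "z \<in> plaque D c u"
    obtain j where j: "z \<in> U j" using cover[of z] by (auto simp: U_def)
    obtain N where N: "open N" "z \<in> N" "N \<subseteq> fst c \<inter> U j"
      and compat: "\<And>y z. y \<in> N \<Longrightarrow> z \<in> N \<Longrightarrow> transverse D (snd c y) = transverse D (snd c z) \<Longrightarrow>
        height j y = height j z"
      using compatible_flow_box[OF c plaque_eq(1)[OF z] j] by metis
    have "z \<in> reach x \<longleftrightarrow> y \<in> reach x" if y: "y \<in> plaque D c u \<inter> N" for y
    proof -
      have "transverse D (snd c y) = transverse D (snd c z)"
        using y plaque_eq(2)[OF z] plaque_eq(2)[of y D c u] by auto
      then have "height j y = height j z"
        using y N(2) by (intro compat) auto
      moreover have "y \<in> U j" using y N(3) by blast
      ultimately have "y \<in> slice j z" "z \<in> slice j y"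
        using j by (simp_all add: slice_def)
      with j \<open>y \<in> U j\<close> show ?thesis by (metis reach_slice)
    qed
    moreover have "openin (top_of_set (plaque D c u)) (plaque D c u \<inter> N)"
      by (rule openin_open_Int[OF N(1)])
    moreover have "z \<in> plaque D c u \<inter> N" using z N(2) by blast
    ultimately show "\<exists>T. openin (top_of_set (plaque D c u)) T \<and> z \<in> T \<and>
        (\<forall>y\<in>T. (z \<in> reach x) = (y \<in> reach x))"
      by blast
  qed auto
  with u show ?thesis by simp
qed

lemma leaf_subset_reach: "leaf D F x \<subseteq> reach x"
proof
  fix y assume "y \<in> leaf D F x"
  then have "(\<lambda>u v. \<exists>c\<in>F. u \<in> fst c \<and> v \<in> plaque D c u)\<^sup>*\<^sup>* x y" by (simp add: leaf_def)
  then show "y \<in> reach x"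
  proof induction
    case base
    show ?case unfolding reach_def slice_def
      by (intro CollectI allI impI exI[of _ "[]"]) simp
  next
    case (step u v)
    then show ?case by (metis reach_plaque)
  qed
qed

definition stop :: "nat \<Rightarrow> 'm \<Rightarrow> 'm" where
  "stop n = walk (from_nat n)"

lemma leaf_reached:
  assumes "y \<in> leaf D F x" "y \<in> U i"
  shows "\<exists>n. stop n x \<in> slice i y"
proof -
  obtain ws where "walk ws x \<in> slice i y"
    using assms leaf_subset_reach unfolding reach_def by blast
  then show ?thesis by (intro exI[of _ "to_nat ws"]) (simp add: stop_def)
qed

end

subsection \<open>Measurability of leafwise integrals\<close>

locale metric_flow_boxes = flow_boxes F D C Q
  for F :: "('m::{second_countable_topology, t2_space}, 'e::euclidean_space) chart set"
    and D :: "'e set"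
    and C :: "nat \<Rightarrow> ('m, 'e) chart" and Q :: "nat \<Rightarrow> 'e set" +
  fixes g :: "('m, 'e) chart \<Rightarrow> 'e \<Rightarrow> 'e \<Rightarrow> 'e \<Rightarrow> real"
    and \<mu> :: "'m set \<Rightarrow> 'm measure"
  assumes continuous_metric: "continuous_on (Q i) (\<lambda>e. g (C i) e u v)"
    and leaf_measure: "leaf_riemannian_measure D F g (leaf D F x) (\<mu> (leaf D F x))"
begin

text \<open>Here and in \<open>patch\<close> and \<open>level\<close>, extension by a constant turns
  a function that is continuous only on an open set into a total Borel function. Since
  \<open>weight\<close> is 0 off \<open>Q i\<close>, the arbitrary value of \<open>patch\<close>
  there is harmless.\<close>

definition weight :: "nat \<Rightarrow> 'e \<Rightarrow> ennreal" where
  "weight i e = ennreal (if e \<in> Q i then sqrt (gram_det D (g (C i) e)) else 0)"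

definition patch :: "nat \<Rightarrow> 'e \<Rightarrow> 'm" where
  "patch i e = (if e \<in> Q i then point i e else undefined)"

definition level :: "nat \<Rightarrow> 'm \<Rightarrow> 'e" where
  "level i x = (if x \<in> U i then height i x else 0)"

definition tangent :: "('e \<Rightarrow> real) \<Rightarrow> 'e" where
  "tangent s = (\<Sum>b\<in>D. s b *\<^sub>R b)"

definition coords :: "('e \<Rightarrow> real) measure" where
  "coords = (\<Pi>\<^sub>M b\<in>D. lborel)"

lemma U_sets [measurable]: "U i \<in> sets borel" and Q_sets [measurable]: "Q i \<in> sets borel"
  by (simp_all add: open_U open_Q)

lemma borel_patch [measurable]: "patch i \<in> borel_measurable borel"
  unfolding patch_def by (intro borel_measurable_continuous_on_if continuous_point) auto

lemma borel_weight [measurable]: "weight i \<in> borel_measurable borel"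
proof -
  have "continuous_on (Q i) (\<lambda>e. sqrt (gram_det D (g (C i) e)))"
    unfolding gram_det_def by (intro continuous_intros continuous_metric)
  then have "(\<lambda>e. if e \<in> Q i then sqrt (gram_det D (g (C i) e)) else 0) \<in> borel_measurable borel"
    by (intro borel_measurable_continuous_on_if) auto
  then show ?thesis unfolding weight_def by measurable
qed

lemma borel_level [measurable]: "level i \<in> borel_measurable borel"
proof -
  have "continuous_on (U i) (height i)"
    unfolding height_def
    by (intro continuous_on_compose2[OF continuous_on_transverse continuous_chart]) auto
  then show ?thesis
    unfolding level_def by (intro borel_measurable_continuous_on_if) auto
qed

lemma borel_slide [measurable]: "slide i d \<in> borel_measurable borel"
proof -
  have "slide i d = (\<lambda>x. if x \<in> U i \<and> level i x + (d - transverse D d) \<in> Q i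
      then patch i (level i x + (d - transverse D d)) else x)"
    by (auto simp: slide_def level_def patch_def Let_def fun_eq_iff)
  then show ?thesis by simp
qed

lemma borel_walk: "walk ws \<in> borel_measurable borel"
proof (induction ws rule: rev_induct)
  case Nil
  have "walk [] = (\<lambda>x. x)" by auto
  then show ?case by simp
next
  case (snoc w ws)
  note [measurable] = this
  obtain i n where w: "w = (i, n)" by (cases w)
  have "walk (ws @ [w]) = (\<lambda>x. slide i (dense_seq n) (walk ws x))" by (auto simp: w)
  then show ?case by simp
qed

lemma borel_stop [measurable]: "stop n \<in> borel_measurable borel"
  unfolding stop_def by (rule borel_walk)

lemma borel_tangent [measurable]: "tangent \<in> borel_measurable coords"
  unfolding tangent_def coords_def by measurable

lemma slice_sets [measurable]:
  assumes "z \<in> U i" shows "slice i z \<in> sets borel"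
proof -
  have "slice i z = {y. y \<in> U i \<and> level i y = level i z}"
    using assms by (auto simp: slice_def level_def)
  then show ?thesis by simp
qed

lemma space_leaf_measure: "space (\<mu> (leaf D F x)) = leaf D F x"
  and sets_leaf_measure: "sets (\<mu> (leaf D F x)) = sets (restrict_space borel (leaf D F x))"
  using leaf_measure[of x] by (simp_all add: leaf_riemannian_measure_def)

lemma measurable_leaf_measure:
  "f \<in> measurable borel N \<Longrightarrow> f \<in> measurable (\<mu> (leaf D F x)) N"
  using measurable_restrict_space1 measurable_cong_sets[OF sets_leaf_measure refl] by blast

lemma lborel_span_eq: "lborel_span D = distr coords borel tangent"
  by (simp add: lborel_span_def coords_def tangent_def[abs_def])

lemma emeasure_slice:
  assumes z: "z \<in> U i" and B: "B \<in> sets borel"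
  shows "emeasure (\<mu> (leaf D F z)) (slice i z \<inter> B) =
    (\<integral>\<^sup>+ s. indicator B (patch i (height i z + tangent s)) * weight i (height i z + tangent s) \<partial>coords)"
proof -
  let ?k = "snd (C i)"
  let ?e = "\<lambda>s. height i z + s"
  have z': "z \<in> fst (C i) \<inter> leaf D F z" using z self_in_leaf by (auto simp: U_def)
  have "slice i z \<inter> B \<in> sets borel" using z B by simp
  moreover have "slice i z \<inter> B \<subseteq> plaque D (C i) z" using slice_subset_plaque[OF z] by auto
  ultimately have "emeasure (\<mu> (leaf D F z)) (slice i z \<inter> B) =
      (\<integral>\<^sup>+ s. indicator (?k ` (slice i z \<inter> B)) (?e s) *
             ennreal (sqrt (gram_det D (g (C i) (?e s)))) \<partial>lborel_span D)"
    using leaf_measure[of z] z' C[of i] unfolding leaf_riemannian_measure_def height_def by blast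
  \<comment> \<open>The condition on \<open>transverse D e\<close> is kept for the moment, because
    \<open>lborel_span D\<close> is a measure on the whole model space and the integrands are
    compared pointwise. After the change to \<open>coords\<close> it holds at every
    argument.\<close>
  also have "\<dots> = (\<integral>\<^sup>+ s. indicator {e. transverse D e = height i z \<and> patch i e \<in> B} (?e s) *
             weight i (?e s) \<partial>lborel_span D)"
  proof (intro nn_integral_cong)
    fix s
    have "?e s \<in> ?k ` (slice i z \<inter> B) \<longleftrightarrow>
        ?e s \<in> Q i \<and> transverse D (?e s) = height i z \<and> patch i (?e s) \<in> B"
    proof
      assume "?e s \<in> ?k ` (slice i z \<inter> B)"
      then obtain y where "y \<in> slice i z" "y \<in> B" "?e s = ?k y" by blast
      then show "?e s \<in> Q i \<and> transverse D (?e s) = height i z \<and> patch i (?e s) \<in> B"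
        by (simp add: slice_def chart_in_Q point_chart patch_def height_def)
    next
      assume *: "?e s \<in> Q i \<and> transverse D (?e s) = height i z \<and> patch i (?e s) \<in> B"
      then show "?e s \<in> ?k ` (slice i z \<inter> B)"
        by (intro image_eqI[of _ _ "point i (?e s)"])
          (auto simp: chart_point slice_def point_in_U patch_def height_def)
    qed
    then show "indicator (?k ` (slice i z \<inter> B)) (?e s) *
             ennreal (sqrt (gram_det D (g (C i) (?e s)))) =
        indicator {e. transverse D e = height i z \<and> patch i e \<in> B} (?e s) * weight i (?e s)"
      by (auto simp: weight_def indicator_def)
  qed
  also have "\<dots> = (\<integral>\<^sup>+ s. indicator {e. transverse D e = height i z \<and> patch i e \<in> B} (?e (tangent s)) *
             weight i (?e (tangent s)) \<partial>coords)"
  proof -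
    have "{e. transverse D e = height i z} \<in> sets borel"
      by (intro borel_closed closed_Collect_eq continuous_on_transverse continuous_on_const)
    moreover have "{e. patch i e \<in> B} \<in> sets borel" using B by simp
    ultimately have "{e. transverse D e = height i z} \<inter> {e. patch i e \<in> B} \<in> sets borel"
      by (rule sets.Int)
    then have [measurable]: "{e. transverse D e = height i z \<and> patch i e \<in> B} \<in> sets borel"
      by (simp add: Collect_conj_eq)
    show ?thesis unfolding lborel_span_eq by (intro nn_integral_distr) simp_all
  qed
  also have "\<dots> = (\<integral>\<^sup>+ s. indicator B (patch i (?e (tangent s))) * weight i (?e (tangent s)) \<partial>coords)"
    using transverse_leaf_direction[OF D]
    by (intro nn_integral_cong) (auto simp: indicator_def transverse_add tangent_def height_def)
  finally show ?thesis .
qed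

text \<open>The formula for sets says that two measures on the manifold coincide: the leaf measure
  restricted to the slice, and the image of the weighted coordinate measure. Their equality gives
  the formula for all Borel integrands at once.\<close>

lemma nn_integral_slice:
  fixes f :: "'m \<Rightarrow> ennreal"
  assumes z: "z \<in> U i" and f [measurable]: "f \<in> borel_measurable borel"
  shows "(\<integral>\<^sup>+ y. indicator (slice i z) y * f y \<partial>\<mu> (leaf D F z)) =
    (\<integral>\<^sup>+ s. weight i (height i z + tangent s) * f (patch i (height i z + tangent s)) \<partial>coords)"
proof -
  let ?\<nu> = "\<mu> (leaf D F z)"
  note [measurable] = slice_sets[OF z]
  have id [measurable]: "(\<lambda>y. y) \<in> measurable ?\<nu> borel" and
    ind [measurable]: "indicator (slice i z) \<in> borel_measurable ?\<nu>"
    and f' [measurable]: "f \<in> borel_measurable ?\<nu>"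
    by (rule measurable_leaf_measure; simp)+
  define N1 where "N1 = distr (density ?\<nu> (indicator (slice i z))) borel (\<lambda>y. y)"
  define N2 where "N2 = distr (density coords (\<lambda>s. weight i (height i z + tangent s))) borel
    (\<lambda>s. patch i (height i z + tangent s))"
  have "N1 = N2"
  proof (rule measure_eqI)
    fix B assume "B \<in> sets N1"
    then have B [measurable]: "B \<in> sets borel" by (simp add: N1_def)
    let ?L = "leaf D F z"
    have BL: "B \<inter> ?L \<in> sets ?\<nu>" "slice i z \<inter> B \<in> sets ?\<nu>"
    proof -
      show "B \<inter> ?L \<in> sets ?\<nu>"
        unfolding sets_leaf_measure sets_restrict_space Int_commute[of B] by (rule imageI[OF B])
      have "slice i z \<inter> B = ?L \<inter> (slice i z \<inter> B)" using slice_subset_leaf[OF z] by auto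
      moreover have "slice i z \<inter> B \<in> sets borel" by measurable
      ultimately show "slice i z \<inter> B \<in> sets ?\<nu>"
        unfolding sets_leaf_measure sets_restrict_space by (rule image_eqI)
    qed
    have "emeasure N1 B = emeasure (density ?\<nu> (indicator (slice i z))) (B \<inter> ?L)"
      unfolding N1_def by (subst emeasure_distr) (auto simp: space_leaf_measure)
    also have "\<dots> = (\<integral>\<^sup>+ y. indicator (slice i z) y * indicator (B \<inter> ?L) y \<partial>?\<nu>)"
      by (subst emeasure_density) (use BL in auto)
    also have "\<dots> = (\<integral>\<^sup>+ y. indicator (slice i z \<inter> B) y \<partial>?\<nu>)"
      by (intro nn_integral_cong) (auto simp: indicator_def space_leaf_measure)
    also have "\<dots> = emeasure ?\<nu> (slice i z \<inter> B)" using BL by simp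
    also have "\<dots> = (\<integral>\<^sup>+ s. indicator B (patch i (height i z + tangent s)) *
        weight i (height i z + tangent s) \<partial>coords)"
      by (rule emeasure_slice[OF z B])
    also have "\<dots> = emeasure N2 B"
      unfolding N2_def
      by (subst emeasure_distr, measurable, subst emeasure_density)
        (auto intro!: nn_integral_cong simp: indicator_def)
    finally show "emeasure N1 B = emeasure N2 B" .
  qed (simp add: N1_def N2_def)
  have "(\<integral>\<^sup>+ y. indicator (slice i z) y * f y \<partial>?\<nu>) = (\<integral>\<^sup>+ y. f y \<partial>N1)"
    unfolding N1_def by (simp add: nn_integral_distr nn_integral_density)
  also have "\<dots> = (\<integral>\<^sup>+ s. weight i (height i z + tangent s) * f (patch i (height i z + tangent s)) \<partial>coords)"
    unfolding \<open>N1 = N2\<close> N2_def by (simp add: nn_integral_distr nn_integral_density)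
  finally show ?thesis .
qed

text \<open>The sheets \<open>k\<close> of \<open>x\<close> enumerate, with repetitions and overlaps, the slices contained in the leaf of
  \<open>x\<close>; its cells form a partition of that leaf.\<close>

definition sheet :: "nat \<Rightarrow> 'm \<Rightarrow> 'm \<Rightarrow> bool" where
  "sheet k x y \<longleftrightarrow> (case prod_decode k of (i, n) \<Rightarrow>
     y \<in> U i \<and> stop n x \<in> U i \<and> level i y = level i (stop n x))"

definition cell :: "nat \<Rightarrow> 'm \<Rightarrow> 'm \<Rightarrow> bool" where
  "cell k x y \<longleftrightarrow> sheet k x y \<and> (\<forall>m<k. \<not> sheet m x y)"

lemma sheet_measurable [measurable]:
  assumes [measurable]: "f \<in> measurable M borel" "h \<in> measurable M borel"
  shows "Measurable.pred M (\<lambda>w. sheet k (f w) (h w))"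
  unfolding sheet_def by (cases "prod_decode k") simp

lemma cell_measurable [measurable]:
  assumes [measurable]: "f \<in> measurable M borel" "h \<in> measurable M borel"
  shows "Measurable.pred M (\<lambda>w. cell k (f w) (h w))"
  unfolding cell_def by measurable

lemma cell_ex1:
  assumes "y \<in> leaf D F x"
  shows "\<exists>!k. cell k x y"
proof -
  obtain i where i: "y \<in> U i" using cover[of y] by (auto simp: U_def)
  obtain n where "stop n x \<in> slice i y" using leaf_reached[OF assms i] by blast
  with i have "sheet (prod_encode (i, n)) x y" by (simp add: sheet_def slice_def level_def)
  then have "cell (LEAST k. sheet k x y) x y"
    unfolding cell_def by (metis LeastI not_less_Least)
  moreover have "k = k'" if "cell k x y" "cell k' x y" for k k'
    using that unfolding cell_def by (meson linorder_neqE_nat)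
  ultimately show ?thesis by blast
qed

text \<open>The right-hand side makes the dependence on \<open>x\<close> tractable: the measure
  \<open>coords\<close> is the same for all leaves, and \<open>x\<close> enters only through the
  Borel map \<open>stop n\<close> and the jointly measurable relation \<open>cell\<close>.\<close>

lemma nn_integral_cell:
  fixes f :: "'m \<Rightarrow> ennreal"
  assumes f [measurable]: "f \<in> borel_measurable borel" and k: "prod_decode k = (i, n)"
  shows "(\<integral>\<^sup>+ y. indicator {y. cell k x y} y * f y \<partial>\<mu> (leaf D F x)) =
    indicator (U i) (stop n x) * (\<integral>\<^sup>+ s. weight i (level i (stop n x) + tangent s) *
      (indicator {y. cell k x y} (patch i (level i (stop n x) + tangent s)) *
       f (patch i (level i (stop n x) + tangent s))) \<partial>coords)"
proof (cases "stop n x \<in> U i")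
  case True
  have leaf: "leaf D F (stop n x) = leaf D F x"
    unfolding stop_def by (intro leaf_eq walk_in_leaf)
  have "(\<integral>\<^sup>+ y. indicator {y. cell k x y} y * f y \<partial>\<mu> (leaf D F x)) =
      (\<integral>\<^sup>+ y. indicator (slice i (stop n x)) y * (indicator {y. cell k x y} y * f y)
        \<partial>\<mu> (leaf D F (stop n x)))"
    unfolding leaf using k True
    by (intro nn_integral_cong) (auto simp: indicator_def slice_def cell_def sheet_def level_def)
  also have "\<dots> = (\<integral>\<^sup>+ s. weight i (height i (stop n x) + tangent s) *
      (indicator {y. cell k x y} (patch i (height i (stop n x) + tangent s)) *
       f (patch i (height i (stop n x) + tangent s))) \<partial>coords)"
    by (rule nn_integral_slice[OF True]) measurable
  finally show ?thesis using True by (simp add: level_def)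
next
  case False
  then have "\<not> cell k x y" for y using k by (simp add: cell_def sheet_def)
  with False show ?thesis by simp
qed

lemma nn_integral_leaf:
  fixes f :: "'m \<Rightarrow> ennreal"
  assumes [measurable]: "f \<in> borel_measurable borel"
  shows "(\<integral>\<^sup>+ y. f y \<partial>\<mu> (leaf D F x)) =
    (\<Sum>k. \<integral>\<^sup>+ y. indicator {y. cell k x y} y * f y \<partial>\<mu> (leaf D F x))"
proof -
  have "f y = (\<Sum>k. indicator {y. cell k x y} y * f y)" if y: "y \<in> leaf D F x" for y
  proof -
    obtain k where k: "cell k x y" "\<And>l. cell l x y \<Longrightarrow> l = k" using cell_ex1[OF y] by blast
    have "(\<lambda>l. indicator {y. cell l x y} y * f y) = (\<lambda>l. if l = k then f y else 0)"
    proof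
      fix l
      show "indicator {y. cell l x y} y * f y = (if l = k then f y else 0)"
        using k(1) k(2)[of l] by (cases "l = k") (auto simp: indicator_def)
    qed
    then show ?thesis using sums_unique[OF sums_single[of k "\<lambda>_. f y"]] by simp
  qed
  then have "(\<integral>\<^sup>+ y. f y \<partial>\<mu> (leaf D F x)) =
      (\<integral>\<^sup>+ y. (\<Sum>k. indicator {y. cell k x y} y * f y) \<partial>\<mu> (leaf D F x))"
    by (intro nn_integral_cong) (simp add: space_leaf_measure)
  also have "\<dots> = (\<Sum>k. \<integral>\<^sup>+ y. indicator {y. cell k x y} y * f y \<partial>\<mu> (leaf D F x))"
    by (intro nn_integral_suminf measurable_leaf_measure) measurable
  finally show ?thesis .
qed

theorem borel_nn_integral_leaf:
  fixes f :: "'m \<Rightarrow> ennreal"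
  assumes [measurable]: "f \<in> borel_measurable borel"
  shows "(\<lambda>x. \<integral>\<^sup>+ y. f y \<partial>\<mu> (leaf D F x)) \<in> borel_measurable borel"
proof -
  interpret product_sigma_finite "\<lambda>_::'e. lborel :: real measure"
    by standard
  \<comment> \<open>Measurability of an integral in a parameter rests on a sigma-finite measure;
    \<open>coords\<close> is a product over the finite set \<open>D\<close>.\<close>
  interpret sigma_finite_measure coords
    unfolding coords_def by (rule sigma_finite) (rule finite_subset[OF D finite_Basis])
  have "(\<lambda>x. \<integral>\<^sup>+ y. indicator {y. cell k x y} y * f y \<partial>\<mu> (leaf D F x)) \<in> borel_measurable borel" for k
  proof -
    obtain i n where k: "prod_decode k = (i, n)" by fastforce
    have [measurable]: "(\<lambda>w. indicator {y. cell k (fst w) y} (h w) :: ennreal) \<in> borel_measurable M"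
      if [measurable]: "h \<in> borel_measurable M" "fst \<in> borel_measurable M" 
      for h and M :: "('m \<times> ('e \<Rightarrow> real)) measure"
      unfolding indicator_def mem_Collect_eq by measurable
    have "(\<lambda>x. \<integral>\<^sup>+ s. weight i (level i (stop n x) + tangent s) *
      (indicator {y. cell k x y} (patch i (level i (stop n x) + tangent s)) *
       f (patch i (level i (stop n x) + tangent s))) \<partial>coords) \<in> borel_measurable borel"
      by (rule borel_measurable_nn_integral) (simp add: split_beta')
    then show ?thesis
      unfolding nn_integral_cell[OF assms k] by measurable
  qed
  then show ?thesis
    unfolding nn_integral_leaf[OF assms] by (rule borel_measurable_suminf_order)
qed

end

text \<open>Balls in chart images supply convex boxes around every point, and second countability
  reduces them to a sequence by the Lindelof property. The smooth metric enters through the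
  continuity of its coefficients.\<close>

lemma obtain_metric_flow_boxes:
  fixes A F :: "('m::{second_countable_topology, t2_space}, 'e::euclidean_space) chart set"
  assumes A: "smooth_atlas A" and g: "riemannian_metric A g" and F: "foliation A D F"
    and \<mu>: "\<And>L. L \<in> leaves D F \<Longrightarrow> leaf_riemannian_measure D F g L (\<mu> L)"
  obtains C Q where "metric_flow_boxes F D C Q g \<mu>"
proof -
  have chart: "is_chart c" if "c \<in> F" for c
    using A F that by (auto simp: smooth_atlas_def foliation_def)
  define boxes where "boxes = {(c, Q). c \<in> F \<and> open Q \<and> convex Q \<and> Q \<subseteq> snd c ` fst c}"
  define dom where "dom = (\<lambda>(c :: ('m, 'e) chart, Q). fst c \<inter> snd c -` Q)"
  have "open (dom b)" if "b \<in> boxes" for b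
  proof -
    obtain c Q where b: "b = (c, Q)" by (cases b)
    then have "is_chart c" "open Q" using that chart by (auto simp: boxes_def)
    then show ?thesis
      unfolding b dom_def prod.case is_chart_def
      by (intro continuous_open_preimage) (auto simp: homeomorphism_def)
  qed
  then obtain \<F> where \<F>: "\<F> \<subseteq> dom ` boxes" "countable \<F>" "\<Union>\<F> = \<Union>(dom ` boxes)"
    using Lindelof[of "dom ` boxes"] by (metis imageE)
  have "x \<in> \<Union>(dom ` boxes)" for x
  proof -
    obtain c where c: "c \<in> F" "x \<in> fst c"
      using F unfolding foliation_def by (metis UNIV_I UN_E)
    then have "open (snd c ` fst c)" using chart by (auto simp: is_chart_def)
    then obtain r where r: "r > 0" "ball (snd c x) r \<subseteq> snd c ` fst c"
      using c open_contains_ball by (metis imageI)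
    then have "(c, ball (snd c x) r) \<in> boxes" using c by (simp add: boxes_def)
    moreover have "x \<in> dom (c, ball (snd c x) r)" using c r by (simp add: dom_def)
    ultimately show ?thesis by blast
  qed
  with \<F> have cover: "\<Union>\<F> = UNIV" by auto
  then have "\<F> \<noteq> {}" by auto
  then have \<F>_range: "range (from_nat_into \<F>) = \<F>" using \<F>(2) by (rule range_from_nat_into)
  \<comment> \<open>Lindelof selects domains only, so a chart with a coordinate set is chosen anew
    for each of them.\<close>
  have "\<exists>b. b \<in> boxes \<and> dom b = from_nat_into \<F> n" for n
    using \<F>(1) from_nat_into[OF \<open>\<F> \<noteq> {}\<close>, of n] by (metis imageE subsetD)
  then obtain b where b: "\<And>n. b n \<in> boxes" "\<And>n. dom (b n) = from_nat_into \<F> n" by metis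
  define C where "C = fst \<circ> b"
  define Q where "Q = snd \<circ> b"
  have bCQ: "b n = (C n, Q n)" for n by (simp add: C_def Q_def)
  have box: "C n \<in> F" "open (Q n)" "convex (Q n)" "Q n \<subseteq> snd (C n) ` fst (C n)" for n
    using b(1)[of n] by (auto simp: bCQ boxes_def)
  have "metric_flow_boxes F D C Q g \<mu>"
  proof
    show "is_chart c" if "c \<in> F" for c by (rule chart[OF that])
    show "D \<subseteq> Basis" using F by (simp add: foliation_def)
    show "\<exists>N. open N \<and> x \<in> N \<and> N \<subseteq> fst c \<inter> fst c' \<and>
        (\<forall>y\<in>N. \<forall>z\<in>N. transverse D (snd c y) = transverse D (snd c z) \<longrightarrow>
           transverse D (snd c' y) = transverse D (snd c' z))"
      if "c \<in> F" "c' \<in> F" "x \<in> fst c" "x \<in> fst c'" for c c' x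
      using F that unfolding foliation_def by blast
    show "\<exists>i. x \<in> fst (C i) \<and> snd (C i) x \<in> Q i" for x
    proof -
      obtain n where "x \<in> dom (b n)" using cover \<F>_range b(2) by (metis UNIV_I UnionE imageE)
      then show ?thesis by (auto simp: bCQ dom_def)
    qed
    show "continuous_on (Q i) (\<lambda>e. g (C i) e u v)" for i u v
    proof -
      have "C i \<in> A" using box(1)[of i] F by (auto simp: foliation_def)
      then have "Ck_on 0 (snd (C i) ` fst (C i)) (\<lambda>e. g (C i) e u v)"
        using g unfolding riemannian_metric_def smooth_on_def by blast
      then show ?thesis using box(4)[of i] by (auto intro: continuous_on_subset)
    qed
    show "leaf_riemannian_measure D F g (leaf D F x) (\<mu> (leaf D F x))" for x
      by (rule \<mu>) (simp add: leaves_def)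
  qed (rule box)+
  then show thesis by (rule that)
qed

subsection \<open>Extremal functions\<close>

text \<open>Used in two roles: as a domination that makes \<open>f0 powr (p - 1) * \<phi>\<close>
  integrable, and, rearranged, as the tangent inequality of the convex function
  \<open>x powr p\<close>.\<close>

lemma Youngs_inequality_powr:
  fixes a b p :: real
  assumes "p > 1" "a \<ge> 0" "b \<ge> 0"
  shows "a * b powr (p - 1) \<le> a powr p / p + (1 - 1 / p) * b powr p"
proof -
  define q where "q = p / (p - 1)"
  have q: "q > 1" "1 / p + 1 / q = 1" "(p - 1) * q = p" "1 / q = 1 - 1 / p"
    using assms by (auto simp: q_def field_simps)
  have "a * b powr (p - 1) \<le> a powr p / p + (b powr (p - 1)) powr q / q"
    by (rule Youngs_inequality) (use assms q in auto)
  also have "(b powr (p - 1)) powr q / q = (1 - 1 / p) * b powr p"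
    unfolding powr_powr q(3) q(4)[symmetric] by simp
  finally show ?thesis .
qed

lemma powr_add_le:
  fixes a b p :: real
  assumes "p \<ge> 0" "a \<ge> 0" "b \<ge> 0"
  shows "(a + b) powr p \<le> 2 powr p * (a powr p + b powr p)"
proof -
  have "(a + b) powr p \<le> (2 * max a b) powr p"
    using assms by (intro powr_mono2) auto
  also have "\<dots> = 2 powr p * max a b powr p"
    using assms by (simp add: powr_mult)
  also have "\<dots> \<le> 2 powr p * (a powr p + b powr p)"
    by (intro mult_left_mono) (auto simp: max_def)
  finally show ?thesis .
qed

text \<open>Preimages under \<open>h\<close> and \<open>f\<close> differ by subsets of null sets,
  which the completion measures. In this way expressions in \<open>hat\<close> become measurable
  once they agree almost everywhere with Borel ones.\<close>

lemma measurable_completion_AE: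
  assumes f: "f \<in> borel_measurable M" and eq: "AE x in M. h x = f x"
  shows "h \<in> borel_measurable (completion M)"
proof (rule measurableI)
  fix A :: "'b set" assume A: "A \<in> sets borel"
  let ?C = "completion M"
  have "AE x in M. \<not> (h x \<in> A \<and> h x \<noteq> f x)"
    using eq by eventually_elim simp
  moreover have "AE x in M. \<not> h x \<noteq> f x"
    using eq by eventually_elim simp
  ultimately have "{x \<in> space ?C. h x \<in> A \<and> h x \<noteq> f x} \<in> sets ?C"
    "{x \<in> space ?C. h x \<noteq> f x} \<in> sets ?C"
    by (simp_all only: sets_completion_AE[unfolded pred_def])
  moreover have "f -` A \<inter> space ?C \<in> sets ?C"
    using measurable_sets[OF measurable_completion[OF f] A] .
  ultimately have "{x \<in> space ?C. h x \<in> A \<and> h x \<noteq> f x} \<union>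
      (f -` A \<inter> space ?C - {x \<in> space ?C. h x \<noteq> f x}) \<in> sets ?C"
    by (intro sets.Un sets.Diff)
  also have "{x \<in> space ?C. h x \<in> A \<and> h x \<noteq> f x} \<union>
      (f -` A \<inter> space ?C - {x \<in> space ?C. h x \<noteq> f x}) = h -` A \<inter> space ?C"
    by auto
  finally show "h -` A \<inter> space ?C \<in> sets ?C" .
qed auto

text \<open>This is the transfer device of the proof: the analysis is done for Borel functions and
  \<open>vol\<close> itself, and only the resulting integrals are moved to the completion.\<close>

lemma completion_integral_AE:
  fixes f h :: "'a \<Rightarrow> real"
  assumes f: "f \<in> borel_measurable M" and eq: "AE x in M. h x = f x"
  shows "integral\<^sup>L (completion M) h = integral\<^sup>L M f"
    and "integrable M f \<Longrightarrow> integrable (completion M) h"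
proof -
  have h: "h \<in> borel_measurable (completion M)" by (rule measurable_completion_AE[OF f eq])
  have f': "f \<in> borel_measurable (completion M)" using f by (rule measurable_completion)
  have "integral\<^sup>L (completion M) h = integral\<^sup>L (completion M) f"
    by (rule integral_cong_AE[OF h f' AE_completion[OF eq]])
  then show "integral\<^sup>L (completion M) h = integral\<^sup>L M f"
    by (simp add: integral_completion[OF f])
  have "AE x in completion M. f x = h x" using AE_completion[OF eq] by eventually_elim simp
  then show "integrable (completion M) h" if "integrable M f"
    using integrable_cong_AE_imp[of "completion M" f h] that h by (simp add: integrable_completion[OF f])
qed

section \<open>Integration along leaves and functions constant on leaves\<close>

locale leafwise_measures =
  fixes vol :: "'m::topological_space measure" and lf :: "'m \<Rightarrow> 'm set" and \<mu> :: "'m set \<Rightarrow> 'm measure"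
  assumes sets_vol [measurable_cong]: "sets vol = sets borel"
    and lf_eq: "y \<in> lf x \<Longrightarrow> lf y = lf x"
    and space_leaf: "space (\<mu> (lf x)) = lf x"
    and sets_leaf: "sets (\<mu> (lf x)) = sets (restrict_space borel (lf x))"
    and borel_leaf_nn_integral: "\<And>f :: 'm \<Rightarrow> ennreal. f \<in> borel_measurable borel \<Longrightarrow>
      (\<lambda>x. \<integral>\<^sup>+ y. f y \<partial>\<mu> (lf x)) \<in> borel_measurable borel"
begin

definition lint :: "('m \<Rightarrow> ennreal) \<Rightarrow> 'm \<Rightarrow> ennreal" where
  "lint f x = (\<integral>\<^sup>+ y. f y \<partial>\<mu> (lf x))"

definition lmean :: "('m \<Rightarrow> real) \<Rightarrow> 'm \<Rightarrow> real" where
  "lmean \<phi> x = (\<integral>y. \<phi> y \<partial>\<mu> (lf x))"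

definition saturated :: "('m \<Rightarrow> 'b) \<Rightarrow> bool" where
  "saturated \<xi> \<longleftrightarrow> (\<forall>x. \<forall>y\<in>lf x. \<xi> y = \<xi> x)"

lemma saturatedD: "saturated \<xi> \<Longrightarrow> y \<in> lf x \<Longrightarrow> \<xi> y = \<xi> x"
  by (simp add: saturated_def)

lemma saturated_lint: "saturated (lint f)" and saturated_lmean: "saturated (lmean \<phi>)"
  by (simp_all add: saturated_def lint_def lmean_def lf_eq)

lemma space_vol: "space vol = UNIV"
  using sets_eq_imp_space_eq[OF sets_vol] by simp

lemma borel_measurable_vol: "borel_measurable vol = borel_measurable borel"
  by (rule measurable_cong_sets[OF sets_vol refl])

lemma measurable_leaf: "f \<in> measurable borel N \<Longrightarrow> f \<in> measurable (\<mu> (lf x)) N"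
  using measurable_restrict_space1 measurable_cong_sets[OF sets_leaf refl] by blast

lemma borel_lint [measurable]: "f \<in> borel_measurable borel \<Longrightarrow> lint f \<in> borel_measurable borel"
  using borel_leaf_nn_integral by (simp add: lint_def[abs_def])

lemma lint_cong: "(\<And>y. y \<in> lf x \<Longrightarrow> f y = h y) \<Longrightarrow> lint f x = lint h x"
  unfolding lint_def by (intro nn_integral_cong) (simp add: space_leaf)

lemma lint_mono: "(\<And>y. y \<in> lf x \<Longrightarrow> f y \<le> h y) \<Longrightarrow> lint f x \<le> lint h x"
  unfolding lint_def by (intro nn_integral_mono) (simp add: space_leaf)

lemma lint_cmult: "f \<in> borel_measurable borel \<Longrightarrow> lint (\<lambda>y. c * f y) x = c * lint f x"
  unfolding lint_def by (intro nn_integral_cmult measurable_leaf)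

lemma lint_cmult_saturated:
  assumes "saturated \<xi>" "f \<in> borel_measurable borel"
  shows "lint (\<lambda>y. \<xi> y * f y) x = \<xi> x * lint f x"
  unfolding lint_cmult[OF assms(2), symmetric] by (rule lint_cong) (simp add: saturatedD[OF assms(1)])

lemma lmean_cong: "(\<And>y. y \<in> lf x \<Longrightarrow> f y = h y) \<Longrightarrow> lmean f x = lmean h x"
  unfolding lmean_def by (intro Bochner_Integration.integral_cong) (simp_all add: space_leaf)

lemma lmean_cmult_saturated:
  assumes "saturated \<xi>"
  shows "lmean (\<lambda>y. \<xi> y * \<phi> y) x = \<xi> x * lmean \<phi> x"
proof -
  have "lmean (\<lambda>y. \<xi> y * \<phi> y) x = lmean (\<lambda>y. \<xi> x * \<phi> y) x"
    by (rule lmean_cong) (simp add: saturatedD[OF assms(1)])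
  then show ?thesis by (simp add: lmean_def)
qed

lemma integrable_leaf_iff:
  assumes "\<phi> \<in> borel_measurable borel"
  shows "integrable (\<mu> (lf x)) \<phi> \<longleftrightarrow> lint (\<lambda>y. ennreal \<bar>\<phi> y\<bar>) x < \<infinity>"
  using measurable_leaf[OF assms] by (simp add: integrable_iff_bounded lint_def)

lemma borel_lmean [measurable]:
  assumes [measurable]: "\<phi> \<in> borel_measurable borel"
  shows "lmean \<phi> \<in> borel_measurable borel"
proof -
  \<comment> \<open>The guard matters: on a leaf where \<phi> is not integrable the Bochner integral
    is 0 by convention, while the difference of the truncated parts could be anything.\<close>
  have "lmean \<phi> x = (if lint (\<lambda>y. ennreal \<bar>\<phi> y\<bar>) x < \<infinity>
      then enn2real (lint (\<lambda>y. ennreal (\<phi> y)) x) - enn2real (lint (\<lambda>y. ennreal (- \<phi> y)) x)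
      else 0)" for x
    unfolding integrable_leaf_iff[OF assms, symmetric]
    by (auto simp: lmean_def lint_def real_lebesgue_integral_def not_integrable_integral_eq)
  then show ?thesis by (simp add: measurable_cong[where f = "lmean \<phi>"] cong: measurable_cong)
qed

lemma abs_lmean_le:
  assumes "\<phi> \<in> borel_measurable borel" "lint (\<lambda>y. ennreal \<bar>\<phi> y\<bar>) x \<le> ennreal C" "C \<ge> 0"
  shows "\<bar>lmean \<phi> x\<bar> \<le> C"
proof -
  have "ennreal \<bar>lmean \<phi> x\<bar> \<le> lint (\<lambda>y. ennreal \<bar>\<phi> y\<bar>) x"
    using integral_norm_bound_ennreal[of "\<mu> (lf x)" \<phi>] assms(1,2) integrable_leaf_iff[OF assms(1), of x]
    by (simp add: lmean_def lint_def le_less_trans)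
  then show ?thesis using assms by (metis ennreal_le_iff order_trans)
qed

end

section \<open>Consequences of minimality on unions of leaves\<close>

locale extremal_leafwise = leafwise_measures vol lf \<mu>
  for vol :: "'m::topological_space measure" and lf and \<mu> +
  fixes p :: real and f0 :: "'m \<Rightarrow> real"
  assumes p: "p > 1" and extremal: "extremal (range lf) vol \<mu> p f0"
begin

lemma f0_admissible: "admissible (range lf) \<mu> f0"
  using extremal by (simp add: extremal_def)

lemma borel_f0 [measurable]: "f0 \<in> borel_measurable borel"
  and f0_nonneg: "0 \<le> f0 x"
  and lint_f0_ge: "1 \<le> lint (\<lambda>y. ennreal (f0 y)) x"
  using f0_admissible by (auto simp: admissible_def lint_def)

lemma nn_integral_f0_finite: "(\<integral>\<^sup>+ x. ennreal (f0 x powr p) \<partial>vol) < \<infinity>"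
  using extremal unfolding extremal_def by metis

lemma minimal:
  assumes "admissible (range lf) \<mu> f"
  shows "(\<integral>\<^sup>+ x. ennreal (f0 x powr p) \<partial>vol) \<le> (\<integral>\<^sup>+ x. ennreal (f x powr p) \<partial>vol)"
proof -
  have "modulus (range lf) vol \<mu> p \<le> (\<integral>\<^sup>+ x. ennreal (f x powr p) \<partial>vol)"
    unfolding modulus_def using assms by (intro INF_lower) simp
  then show ?thesis using extremal by (simp add: extremal_def)
qed

lemma nn_integral_split:
  fixes h :: "'m \<Rightarrow> ennreal"
  assumes [measurable]: "h \<in> borel_measurable borel" "S \<in> sets borel"
  shows "(\<integral>\<^sup>+ x. h x \<partial>vol) = (\<integral>\<^sup>+ x. indicator S x * h x \<partial>vol) + (\<integral>\<^sup>+ x. indicator (- S) x * h x \<partial>vol)"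
  by (subst nn_integral_add[symmetric]) (auto intro!: nn_integral_cong simp: indicator_def)

text \<open>Because \<open>S\<close> is a union of leaves, gluing \<open>g\<close> on
  \<open>S\<close> to \<open>f0\<close> elsewhere changes no leafwise integral by mixing, so the
  result is admissible. The contribution of the complement cancels in the comparison, being
  finite.\<close>

lemma replace_le:
  assumes S [measurable]: "S \<in> sets borel" and sat: "saturated (\<lambda>x. x \<in> S)"
    and g [measurable]: "g \<in> borel_measurable borel" and g_nonneg: "\<And>x. 0 \<le> g x"
    and lint_g: "\<And>x. x \<in> S \<Longrightarrow> 1 \<le> lint (\<lambda>y. ennreal (g y)) x"
  shows "(\<integral>\<^sup>+ x. indicator S x * ennreal (f0 x powr p) \<partial>vol) \<le>
    (\<integral>\<^sup>+ x. indicator S x * ennreal (g x powr p) \<partial>vol)"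
proof -
  define f where "f x = (if x \<in> S then g x else f0 x)" for x
  have [measurable]: "f \<in> borel_measurable borel" unfolding f_def by measurable
  have "1 \<le> lint (\<lambda>y. ennreal (f y)) x" for x
  proof (cases "x \<in> S")
    case True
    then have "lint (\<lambda>y. ennreal (f y)) x = lint (\<lambda>y. ennreal (g y)) x"
      using saturatedD[OF sat] by (intro lint_cong) (simp add: f_def)
    with True show ?thesis using lint_g by simp
  next
    case False
    then have "lint (\<lambda>y. ennreal (f y)) x = lint (\<lambda>y. ennreal (f0 y)) x"
      using saturatedD[OF sat] by (intro lint_cong) (simp add: f_def)
    then show ?thesis using lint_f0_ge by simp
  qed
  then have adm: "admissible (range lf) \<mu> f"
    by (auto simp: admissible_def lint_def f_def g_nonneg f0_nonneg)
  let ?A = "\<lambda>h. \<integral>\<^sup>+ x. indicator S x * ennreal (h x powr p) \<partial>vol"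
  let ?B = "\<lambda>h. \<integral>\<^sup>+ x. indicator (- S) x * ennreal (h x powr p) \<partial>vol"
  have "?A f0 + ?B f0 \<le> ?A f + ?B f"
    using minimal[OF adm] by (simp flip: nn_integral_split)
  also have "?A f = ?A g" by (intro nn_integral_cong) (simp add: f_def indicator_def)
  also have "?B f = ?B f0" by (intro nn_integral_cong) (simp add: f_def indicator_def)
  finally have "?B f0 + ?A f0 \<le> ?B f0 + ?A g" by (simp add: add.commute)
  moreover have "?B f0 \<noteq> \<infinity>"
    using nn_integral_f0_finite nn_integral_split[of "\<lambda>x. ennreal (f0 x powr p)" S] by auto
  ultimately show ?thesis by (simp add: ennreal_add_left_cancel_le)
qed

lemma f0_vanishes:
  assumes [measurable]: "S \<in> sets borel"
    and "(\<integral>\<^sup>+ x. indicator S x * ennreal (f0 x powr p) \<partial>vol) = 0"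
  shows "AE x in vol. f0 x \<noteq> 0 \<longrightarrow> x \<notin> S"
proof -
  have "AE x in vol. indicator S x * ennreal (f0 x powr p) = 0"
    using assms(2) by (subst (asm) nn_integral_0_iff_AE) auto
  then show ?thesis by eventually_elim (auto simp: indicator_def)
qed

text \<open>On the leaves that \<open>N\<close> meets in positive measure, a multiple of the
  indicator of \<open>N\<close> is an admissible replacement for \<open>f0\<close>. It costs
  nothing, so \<open>f0\<close> vanishes almost everywhere on those leaves.\<close>

lemma null_set_on_leaves:
  assumes N: "N \<in> null_sets vol"
  shows "AE x in vol. f0 x \<noteq> 0 \<longrightarrow> (AE y in \<mu> (lf x). y \<notin> N)"
proof -
  have N' [measurable]: "N \<in> sets borel" using N sets_vol by auto
  define h where "h = lint (indicator N)"
  have [measurable]: "h \<in> borel_measurable borel" unfolding h_def by measurable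
  have sat: "saturated h" unfolding h_def by (rule saturated_lint)
  define S where "S = {x. h x \<noteq> 0}"
  have S [measurable]: "S \<in> sets borel" unfolding S_def by measurable
  \<comment> \<open>As a function of \<open>h\<close>, the factor is constant on leaves; it is at
    least \<open>1 / h x\<close> where \<open>h x\<close> is finite and positive. The maximum with 1
    handles \<open>h x = \<infinity>\<close>, where the reciprocal is 0 and the product would be
    0.\<close>
  define r where "r x = max 1 (enn2real (1 / h x))" for x
  define g where "g x = r x * indicator N x" for x
  have [measurable]: "g \<in> borel_measurable borel" unfolding g_def r_def by measurable
  have "saturated (\<lambda>x. ennreal (r x))" using sat by (simp add: r_def saturated_def)
  have g_nonneg: "0 \<le> g x" for x by (simp add: g_def r_def)
  have "1 \<le> lint (\<lambda>y. ennreal (g y)) x" if "x \<in> S" for x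
  proof -
    have "lint (\<lambda>y. ennreal (g y)) x = lint (\<lambda>y. ennreal (r y) * indicator N y) x"
      by (rule lint_cong) (simp add: g_def indicator_def)
    also have "\<dots> = ennreal (r x) * h x"
      unfolding h_def by (rule lint_cmult_saturated) (fact, measurable)
    finally have *: "lint (\<lambda>y. ennreal (g y)) x = ennreal (r x) * h x" .
    show ?thesis
    proof (cases "h x = \<infinity>")
      case True
      then show ?thesis by (simp add: * ennreal_mult_top r_def)
    next
      case False
      with that have hx: "h x \<noteq> 0" "h x \<noteq> \<infinity>" by (auto simp: S_def)
      then obtain c where c: "h x = ennreal c" "c > 0"
        by (cases "h x") (auto simp: less_le)
      have "1 / c \<le> r x" using c by (simp add: r_def divide_ennreal flip: ennreal_1)
      then have "1 \<le> r x * c" using c by (simp add: field_simps)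
      then show ?thesis
        unfolding * c(1) using c(2) by (simp add: r_def flip: ennreal_mult ennreal_1)
    qed
  qed
  then have "(\<integral>\<^sup>+ x. indicator S x * ennreal (f0 x powr p) \<partial>vol) \<le>
      (\<integral>\<^sup>+ x. indicator S x * ennreal (g x powr p) \<partial>vol)"
    using sat by (intro replace_le S g_nonneg) (auto simp: S_def saturated_def)
  also have "\<dots> = 0"
  proof -
    have "AE x in vol. indicator S x * ennreal (g x powr p) = 0"
      using AE_not_in[OF N] by eventually_elim (simp add: g_def)
    then show ?thesis by (subst nn_integral_0_iff_AE) auto
  qed
  finally have "AE x in vol. f0 x \<noteq> 0 \<longrightarrow> x \<notin> S" by (intro f0_vanishes S) simp
  moreover have "AE y in \<mu> (lf x). y \<notin> N" if "x \<notin> S" for x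
  proof -
    have "(\<integral>\<^sup>+ y. indicator N y \<partial>\<mu> (lf x)) = 0" using that by (simp add: S_def h_def lint_def)
    then have "AE y in \<mu> (lf x). indicator N y = (0::ennreal)"
      by (subst (asm) nn_integral_0_iff_AE) (auto intro!: measurable_leaf)
    then show ?thesis by eventually_elim (auto simp: indicator_def)
  qed
  ultimately show ?thesis by (auto elim!: eventually_mono)
qed

lemma nn_integral_indicator_f0_finite:
  "(\<integral>\<^sup>+ x. indicator S x * ennreal (f0 x powr p) \<partial>vol) < \<infinity>"
  by (rule le_less_trans[OF nn_integral_mono nn_integral_f0_finite]) (simp add: indicator_def)

text \<open>Where the leafwise integral is at least some \<open>a > 1\<close>, the function
  \<open>f0 / a\<close> is still admissible and multiplies the p-energy by a factor below 1. A
  finite energy not exceeding a proper fraction of itself is 0; the values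
  \<open>a = 1 + 1 / Suc n\<close> exhaust all leafwise integrals above 1.\<close>

lemma lint_f0_eq_1: "AE x in vol. f0 x \<noteq> 0 \<longrightarrow> lint (\<lambda>y. ennreal (f0 y)) x = 1"
proof -
  let ?h = "lint (\<lambda>y. ennreal (f0 y))"
  have "AE x in vol. f0 x \<noteq> 0 \<longrightarrow> x \<notin> {x. ennreal (1 + 1 / real (Suc n)) \<le> ?h x}" for n
  proof (rule f0_vanishes)
    define a where "a = 1 + 1 / real (Suc n)"
    define S where "S = {x. ennreal a \<le> ?h x}"
    show S [measurable]: "{x. ennreal (1 + 1 / real (Suc n)) \<le> ?h x} \<in> sets borel"
      by measurable
    have a: "a > 1" by (simp add: a_def)
    let ?I = "\<integral>\<^sup>+ x. indicator S x * ennreal (f0 x powr p) \<partial>vol"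
    have "?I \<le> (\<integral>\<^sup>+ x. indicator S x * ennreal ((1 / a * f0 x) powr p) \<partial>vol)"
    proof (rule replace_le)
      show "S \<in> sets borel" unfolding S_def a_def by (rule S)
      show "saturated (\<lambda>x. x \<in> S)"
        using saturated_lint[of "\<lambda>y. ennreal (f0 y)"] by (simp add: S_def saturated_def)
      fix x assume x: "x \<in> S"
      have "lint (\<lambda>y. ennreal (1 / a * f0 y)) x = ennreal (1 / a) * ?h x"
        using a by (subst lint_cmult[symmetric]) (auto intro!: lint_cong simp: f0_nonneg simp flip: ennreal_mult)
      moreover have "ennreal (1 / a) * ennreal a \<le> ennreal (1 / a) * ?h x"
        using x by (intro mult_left_mono) (auto simp: S_def)
      moreover have "ennreal (1 / a) * ennreal a = 1" using a by (simp flip: ennreal_mult)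
      ultimately show "1 \<le> lint (\<lambda>y. ennreal (1 / a * f0 y)) x" by simp
    qed (use a f0_nonneg in auto)
    also have "\<dots> = (\<integral>\<^sup>+ x. ennreal ((1 / a) powr p) * (indicator S x * ennreal (f0 x powr p)) \<partial>vol)"
      using a f0_nonneg
      by (intro nn_integral_cong) (auto simp: indicator_def powr_mult powr_divide simp flip: ennreal_mult)
    also have "\<dots> = ennreal ((1 / a) powr p) * ?I"
      by (rule nn_integral_cmult) (use S in \<open>simp add: S_def a_def\<close>)
    finally have le: "?I \<le> ennreal ((1 / a) powr p) * ?I" .
    obtain i where i: "?I = ennreal i" "i \<ge> 0"
      using nn_integral_indicator_f0_finite[of S] by (cases ?I) auto
    have "(1 / a) powr p < 1" using a p powr_less_mono2[of p "1 / a" 1] by simp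
    moreover have "i \<le> (1 / a) powr p * i" using le i a by (simp flip: ennreal_mult)
    ultimately have "i = 0" using i(2) by (smt (verit) mult_le_cancel_right1)
    with i show "(\<integral>\<^sup>+ x. indicator {x. ennreal (1 + 1 / real (Suc n)) \<le> ?h x} x *
        ennreal (f0 x powr p) \<partial>vol) = 0"
      by (simp add: S_def a_def)
  qed
  then have "AE x in vol. \<forall>n. f0 x \<noteq> 0 \<longrightarrow> x \<notin> {x. ennreal (1 + 1 / real (Suc n)) \<le> ?h x}"
    unfolding AE_all_countable by blast
  then show ?thesis
  proof eventually_elim
    case (elim x)
    show ?case
    proof (intro impI antisym lint_f0_ge)
      assume "f0 x \<noteq> 0"
      with elim have *: "?h x \<le> ennreal (1 + 1 / real (Suc n))" for n by (auto simp: not_le less_imp_le)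
      have "(\<lambda>n. ennreal (1 + 1 / real (Suc n))) \<longlonglongrightarrow> ennreal (1 + 0)"
        by (intro tendsto_intros LIMSEQ_Suc[OF lim_const_over_n])
      from LIMSEQ_le_const[OF this, of "?h x"] show "?h x \<le> 1"
        using * by simp
    qed
  qed
qed

text \<open>On leaves where \<bar>\<phi>\<bar> has infinite integral, every positive multiple of
  \<bar>\<phi>\<bar> is an admissible replacement, and its p-energy tends to 0 with the
  factor.\<close>

lemma lint_finite:
  assumes \<phi> [measurable]: "\<phi> \<in> borel_measurable borel"
    and fin: "(\<integral>\<^sup>+ x. ennreal (\<bar>\<phi> x\<bar> powr p) \<partial>vol) < \<infinity>"
  shows "AE x in vol. f0 x \<noteq> 0 \<longrightarrow> lint (\<lambda>y. ennreal \<bar>\<phi> y\<bar>) x < \<infinity>"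
proof -
  let ?h = "lint (\<lambda>y. ennreal \<bar>\<phi> y\<bar>)"
  define S where "S = {x. ?h x = \<infinity>}"
  have S [measurable]: "S \<in> sets borel" unfolding S_def by measurable
  let ?I = "\<integral>\<^sup>+ x. indicator S x * ennreal (f0 x powr p) \<partial>vol"
  obtain b where b: "(\<integral>\<^sup>+ x. ennreal (\<bar>\<phi> x\<bar> powr p) \<partial>vol) = ennreal b" "b \<ge> 0"
    using fin by (cases "\<integral>\<^sup>+ x. ennreal (\<bar>\<phi> x\<bar> powr p) \<partial>vol") auto
  have *: "?I \<le> ennreal ((1 / real (Suc n)) powr p * b)" for n
  proof -
    define e where "e = 1 / real (Suc n)"
    have e: "e > 0" by (simp add: e_def)
    have "?I \<le> (\<integral>\<^sup>+ x. indicator S x * ennreal ((e * \<bar>\<phi> x\<bar>) powr p) \<partial>vol)"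
    proof (rule replace_le[OF S])
      show "saturated (\<lambda>x. x \<in> S)"
        using saturated_lint[of "\<lambda>y. ennreal \<bar>\<phi> y\<bar>"] by (simp add: S_def saturated_def)
      fix x assume x: "x \<in> S"
      have "lint (\<lambda>y. ennreal (e * \<bar>\<phi> y\<bar>)) x = ennreal e * ?h x"
        using e by (subst lint_cmult[symmetric]) (auto intro!: lint_cong simp flip: ennreal_mult)
      then show "1 \<le> lint (\<lambda>y. ennreal (e * \<bar>\<phi> y\<bar>)) x"
        using x e by (simp add: S_def ennreal_mult_top)
    qed (use e in auto)
    also have "\<dots> \<le> (\<integral>\<^sup>+ x. ennreal (e powr p) * ennreal (\<bar>\<phi> x\<bar> powr p) \<partial>vol)"
      using e by (intro nn_integral_mono) (auto simp: indicator_def powr_mult simp flip: ennreal_mult)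
    also have "\<dots> = ennreal (e powr p * b)"
      by (subst nn_integral_cmult) (auto simp: b ennreal_mult)
    finally show ?thesis by (simp add: e_def)
  qed
  have "(\<lambda>n. (1 / real (Suc n)) powr p) \<longlonglongrightarrow> 0 powr p"
    using p by (intro tendsto_powr'[OF LIMSEQ_Suc[OF lim_const_over_n] tendsto_const]) simp
  then have "(\<lambda>n. ennreal ((1 / real (Suc n)) powr p * b)) \<longlonglongrightarrow> ennreal (0 powr p * b)"
    by (intro tendsto_ennrealI tendsto_mult tendsto_const)
  from LIMSEQ_le_const[OF this, of ?I] have "?I \<le> 0" using * by simp
  then have "AE x in vol. f0 x \<noteq> 0 \<longrightarrow> x \<notin> S" by (intro f0_vanishes S) simp
  then show ?thesis by eventually_elim (auto simp: S_def less_top)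
qed

section \<open>L^p bounds and variations of the extremal function\<close>

lemma Lp_spaceD [measurable_dest]: "\<phi> \<in> Lp_space vol p \<Longrightarrow> \<phi> \<in> borel_measurable borel"
  by (simp add: Lp_space_def borel_measurable_vol)

lemma Lp_space_integrable: "\<phi> \<in> Lp_space vol p \<Longrightarrow> integrable vol (\<lambda>x. \<bar>\<phi> x\<bar> powr p)"
  by (simp add: Lp_space_def)

lemma integrable_f0_powr: "integrable vol (\<lambda>x. f0 x powr p)"
  using nn_integral_f0_finite by (intro integrableI_nonneg) auto

text \<open>The competitors and fluctuations constructed below are all bounded by a combination of a
  given L^p function and \<open>f0\<close>, so this one criterion places them in L^p.\<close>

lemma Lp_space_bound:
  assumes [measurable]: "\<eta> \<in> borel_measurable borel" and \<phi>: "\<phi> \<in> Lp_space vol p"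
    and bound: "\<And>x. \<bar>\<eta> x\<bar> \<le> c * \<bar>\<phi> x\<bar> + C * f0 x" and "c \<ge> 0" "C \<ge> 0"
  shows "\<eta> \<in> Lp_space vol p"
proof -
  note [measurable] = Lp_spaceD[OF \<phi>]
  have "integrable vol (\<lambda>x. \<bar>\<eta> x\<bar> powr p)"
  proof (rule Bochner_Integration.integrable_bound)
    show "integrable vol (\<lambda>x. 2 powr p * (c powr p * \<bar>\<phi> x\<bar> powr p + C powr p * f0 x powr p))"
      using Lp_space_integrable[OF \<phi>] integrable_f0_powr by simp
    show "AE x in vol. norm (\<bar>\<eta> x\<bar> powr p) \<le>
        norm (2 powr p * (c powr p * \<bar>\<phi> x\<bar> powr p + C powr p * f0 x powr p))"
    proof (intro AE_I2)
      fix x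
      have "\<bar>\<eta> x\<bar> powr p \<le> (c * \<bar>\<phi> x\<bar> + C * f0 x) powr p"
        using bound p by (intro powr_mono2) auto
      also have "\<dots> \<le> 2 powr p * ((c * \<bar>\<phi> x\<bar>) powr p + (C * f0 x) powr p)"
        using p assms f0_nonneg by (intro powr_add_le) auto
      also have "\<dots> = 2 powr p * (c powr p * \<bar>\<phi> x\<bar> powr p + C powr p * f0 x powr p)"
        using assms f0_nonneg by (simp add: powr_mult)
      finally show "norm (\<bar>\<eta> x\<bar> powr p) \<le>
          norm (2 powr p * (c powr p * \<bar>\<phi> x\<bar> powr p + C powr p * f0 x powr p))" by simp
    qed
  qed measurable
  then show ?thesis by (simp add: Lp_space_def borel_measurable_vol)
qed

lemma integrable_f0_powr_times:
  assumes \<phi>: "\<phi> \<in> Lp_space vol p"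
  shows "integrable vol (\<lambda>x. f0 x powr (p - 1) * \<phi> x)"
proof -
  note [measurable] = Lp_spaceD[OF \<phi>]
  show ?thesis
  proof (rule Bochner_Integration.integrable_bound)
    show "integrable vol (\<lambda>x. \<bar>\<phi> x\<bar> powr p / p + (1 - 1 / p) * f0 x powr p)"
      using Lp_space_integrable[OF \<phi>] integrable_f0_powr by simp
    show "AE x in vol. norm (f0 x powr (p - 1) * \<phi> x) \<le> norm (\<bar>\<phi> x\<bar> powr p / p + (1 - 1 / p) * f0 x powr p)"
    proof (intro AE_I2)
      fix x
      have "norm (f0 x powr (p - 1) * \<phi> x) = \<bar>\<phi> x\<bar> * f0 x powr (p - 1)"
        by (simp add: abs_mult)
      also have "\<dots> \<le> \<bar>\<phi> x\<bar> powr p / p + (1 - 1 / p) * f0 x powr p"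
        using p f0_nonneg by (intro Youngs_inequality_powr) auto
      finally show "norm (f0 x powr (p - 1) * \<phi> x) \<le> norm (\<bar>\<phi> x\<bar> powr p / p + (1 - 1 / p) * f0 x powr p)"
        by simp
    qed
  qed measurable
qed

text \<open>The tangent inequality is used at the perturbed function \<open>u\<close>, so that only the factor \<open>u powr (p - 1)\<close>
  depends on the parameter when it tends to 0.\<close>

lemma first_variation:
  assumes f: "admissible (range lf) \<mu> f" and Lp: "f \<in> Lp_space vol p"
  shows "0 \<le> (\<integral>x. f0 x powr (p - 1) * (f x - f0 x) \<partial>vol)"
proof -
  note [measurable] = Lp_spaceD[OF Lp]
  have f_nonneg: "0 \<le> f x" for x using f by (simp add: admissible_def)
  define t where "t n = 1 / real (Suc n)" for n
  have t: "0 < t n" "t n \<le> 1" for n by (simp_all add: t_def)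
  define u where "u n x = f0 x + t n * (f x - f0 x)" for n x
  have u_eq: "u n x = (1 - t n) * f0 x + t n * f x" for n x by (simp add: u_def algebra_simps)
  have u_nonneg: "0 \<le> u n x" for n x
    unfolding u_eq using t[of n] f0_nonneg f_nonneg by simp
  have u_le: "u n x \<le> f x + f0 x" for n x
    unfolding u_eq using t[of n] f0_nonneg[of x] f_nonneg[of x]
    by (smt (verit) mult_left_le_one_le)
  have [measurable]: "u n \<in> borel_measurable borel" for n unfolding u_def by measurable
  have sum_Lp: "(\<lambda>x. f x + f0 x) \<in> Lp_space vol p"
    by (rule Lp_space_bound[OF _ Lp, of _ 1 1]) (use f_nonneg f0_nonneg in auto)
  have u_Lp: "u n \<in> Lp_space vol p" for n
    by (rule Lp_space_bound[OF _ Lp, of _ 1 1]) (use u_le u_nonneg f_nonneg in auto)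
  have adm: "admissible (range lf) \<mu> (u n)" for n
  proof -
    have "1 \<le> lint (\<lambda>y. ennreal (u n y)) x" for x
    proof -
      have "(1::ennreal) = ennreal (1 - t n) * 1 + ennreal (t n) * 1"
        using t[of n] by (simp flip: ennreal_plus)
      also have "\<dots> \<le> ennreal (1 - t n) * lint (\<lambda>y. ennreal (f0 y)) x +
          ennreal (t n) * lint (\<lambda>y. ennreal (f y)) x"
        using lint_f0_ge[of x] f by (intro add_mono mult_left_mono) (auto simp: admissible_def lint_def)
      also have "\<dots> = lint (\<lambda>y. ennreal (1 - t n) * ennreal (f0 y) + ennreal (t n) * ennreal (f y)) x"
        unfolding lint_def
        by (subst nn_integral_add) (auto intro!: measurable_leaf simp: nn_integral_cmult measurable_leaf)
      also have "\<dots> = lint (\<lambda>y. ennreal (u n y)) x"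
        using t[of n] f0_nonneg f_nonneg
        by (intro lint_cong) (simp add: u_eq flip: ennreal_mult ennreal_plus)
      finally show ?thesis .
    qed
    then show ?thesis using u_nonneg by (auto simp: admissible_def lint_def)
  qed
  have int_up: "integrable vol (\<lambda>x. u n x powr p)" for n
    using Lp_space_integrable[OF u_Lp[of n]] u_nonneg by simp
  \<comment> \<open>Both factors are controlled by \<open>f + f0\<close>, and the exponents add up
    to \<open>p\<close>. The bound does not depend on \<open>n\<close>, so it serves as the
    dominating function of the limit.\<close>
  have bound: "\<bar>u n x powr (p - 1) * (f x - f0 x)\<bar> \<le> (f x + f0 x) powr p" for n x
  proof -
    have "\<bar>u n x powr (p - 1) * (f x - f0 x)\<bar> = u n x powr (p - 1) * \<bar>f x - f0 x\<bar>"
      by (simp add: abs_mult)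
    also have "\<dots> \<le> (f x + f0 x) powr (p - 1) * (f x + f0 x)"
      using p u_nonneg u_le f_nonneg[of x] f0_nonneg[of x] by (intro mult_mono powr_mono2) auto
    also have "\<dots> = (f x + f0 x) powr p"
      using powr_mult_base[of "f x + f0 x" "p - 1"] f_nonneg[of x] f0_nonneg[of x] by (simp add: mult.commute)
    finally show ?thesis .
  qed
  have int_sum: "integrable vol (\<lambda>x. (f x + f0 x) powr p)"
    using Lp_space_integrable[OF sum_Lp] f_nonneg f0_nonneg by simp
  have int_u: "integrable vol (\<lambda>x. u n x powr (p - 1) * (f x - f0 x))" for n
    using bound by (intro Bochner_Integration.integrable_bound[OF int_sum]) auto
  have pos: "0 \<le> (\<integral>x. u n x powr (p - 1) * (f x - f0 x) \<partial>vol)" for n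
  proof -
    have "ennreal (\<integral>x. f0 x powr p \<partial>vol) \<le> ennreal (\<integral>x. u n x powr p \<partial>vol)"
      using minimal[OF adm[of n]] integrable_f0_powr int_up[of n]
      by (simp add: nn_integral_eq_integral)
    then have "(\<integral>x. f0 x powr p \<partial>vol) \<le> (\<integral>x. u n x powr p \<partial>vol)"
      by (simp add: ennreal_le_iff)
    then have "0 \<le> (\<integral>x. (u n x powr p - f0 x powr p) / p \<partial>vol)"
      using p integrable_f0_powr int_up[of n] by simp
    also have "\<dots> \<le> (\<integral>x. t n * (u n x powr (p - 1) * (f x - f0 x)) \<partial>vol)"
    proof (rule integral_mono)
      show "integrable vol (\<lambda>x. (u n x powr p - f0 x powr p) / p)"
        using integrable_f0_powr int_up[of n] by simp
      show "integrable vol (\<lambda>x. t n * (u n x powr (p - 1) * (f x - f0 x)))" using int_u by simp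
      fix x
      \<comment> \<open>Young with \<open>f0\<close> as the linear factor gives the tangent
        inequality at \<open>u n\<close>. The increment \<open>u n - f0\<close> carries the factor
        \<open>t n > 0\<close>, which is divided out after integration.\<close>
      have "f0 x * u n x powr (p - 1) \<le> f0 x powr p / p + (1 - 1 / p) * u n x powr p"
        by (rule Youngs_inequality_powr[OF p f0_nonneg u_nonneg])
      moreover have "u n x * u n x powr (p - 1) = u n x powr p"
        using powr_mult_base[OF u_nonneg, of n x "p - 1"] by simp
      ultimately have "(u n x powr p - f0 x powr p) / p \<le> (u n x - f0 x) * u n x powr (p - 1)"
        by (simp add: algebra_simps diff_divide_distrib)
      then show "(u n x powr p - f0 x powr p) / p \<le> t n * (u n x powr (p - 1) * (f x - f0 x))"
        by (simp add: u_def mult_ac)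
    qed
    also have "\<dots> = t n * (\<integral>x. u n x powr (p - 1) * (f x - f0 x) \<partial>vol)" by simp
    finally show ?thesis using t[of n] by (simp add: zero_le_mult_iff)
  qed
  have "(\<lambda>n. \<integral>x. u n x powr (p - 1) * (f x - f0 x) \<partial>vol) \<longlonglongrightarrow>
      (\<integral>x. f0 x powr (p - 1) * (f x - f0 x) \<partial>vol)"
  proof (rule integral_dominated_convergence[OF _ _ int_sum])
    show "AE x in vol. (\<lambda>n. u n x powr (p - 1) * (f x - f0 x)) \<longlonglongrightarrow> f0 x powr (p - 1) * (f x - f0 x)"
    proof (intro AE_I2)
      fix x
      have "t \<longlonglongrightarrow> 0" unfolding t_def by (rule LIMSEQ_Suc[OF lim_const_over_n])
      then have "(\<lambda>n. u n x) \<longlonglongrightarrow> f0 x + 0 * (f x - f0 x)"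
        unfolding u_def by (intro tendsto_intros)
      \<comment> \<open>The exponent \<open>p - 1\<close> is positive and \<open>u n\<close> is
        nonnegative, which makes the limit valid also where \<open>f0\<close> vanishes.\<close>
      then have "(\<lambda>n. u n x powr (p - 1)) \<longlonglongrightarrow> f0 x powr (p - 1)"
        using p u_nonneg by (intro tendsto_powr'[OF _ tendsto_const]) auto
      then show "(\<lambda>n. u n x powr (p - 1) * (f x - f0 x)) \<longlonglongrightarrow> f0 x powr (p - 1) * (f x - f0 x)"
        by (intro tendsto_mult tendsto_const)
    qed
    show "AE x in vol. norm (u n x powr (p - 1) * (f x - f0 x)) \<le> (f x + f0 x) powr p" for n
      using bound by simp
  qed measurable
  then show ?thesis using pos by (intro LIMSEQ_le_const[where a = 0]) auto
qed

text \<open>The competitors are \<open>max 0 (f0 + t * (\<phi> - f0 * lmean \<phi>))\<close> for small \<open>t\<close>: before taking the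
  positive part, their integral over every leaf in \<open>S\<close> is 1.\<close>

lemma integral_fluctuation_nonneg:
  assumes \<phi>: "\<phi> \<in> Lp_space vol p"
    and sat: "saturated (\<lambda>x. x \<in> S)"
    and S1: "\<And>x. x \<in> S \<Longrightarrow> lint (\<lambda>y. ennreal (f0 y)) x = 1"
    and SC: "\<And>x. x \<in> S \<Longrightarrow> lint (\<lambda>y. ennreal \<bar>\<phi> y\<bar>) x \<le> ennreal C" and C: "C \<ge> 0"
    and off: "\<And>x. x \<notin> S \<Longrightarrow> \<phi> x = 0"
  shows "(\<lambda>x. \<phi> x - f0 x * lmean \<phi> x) \<in> Lp_space vol p"
    and "0 \<le> (\<integral>x. f0 x powr (p - 1) * (\<phi> x - f0 x * lmean \<phi> x) \<partial>vol)"
proof -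
  note [measurable] = Lp_spaceD[OF \<phi>]
  define \<eta> where "\<eta> x = \<phi> x - f0 x * lmean \<phi> x" for x
  have [measurable]: "\<eta> \<in> borel_measurable borel" unfolding \<eta>_def by measurable
  have off_leaf: "\<phi> y = 0" if "x \<notin> S" "y \<in> lf x" for x y
    using that off saturatedD[OF sat that(2)] by simp
  have lmean_off: "lmean \<phi> x = 0" if "x \<notin> S" for x
  proof -
    have "lmean \<phi> x = lmean (\<lambda>_. 0) x" using off_leaf[OF that] by (rule lmean_cong)
    then show ?thesis by (simp add: lmean_def)
  qed
  have lmean_le: "\<bar>lmean \<phi> x\<bar> \<le> C" for x
    using abs_lmean_le[OF Lp_spaceD[OF \<phi>] SC C] lmean_off C by (cases "x \<in> S") auto
  have \<eta>_bound: "\<bar>\<eta> x\<bar> \<le> 1 * \<bar>\<phi> x\<bar> + C * f0 x" for x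
  proof -
    have "\<bar>\<eta> x\<bar> \<le> \<bar>\<phi> x\<bar> + f0 x * \<bar>lmean \<phi> x\<bar>"
      unfolding \<eta>_def using abs_triangle_ineq4[of "\<phi> x" "f0 x * lmean \<phi> x"] f0_nonneg[of x]
      by (simp add: abs_mult)
    also have "f0 x * \<bar>lmean \<phi> x\<bar> \<le> C * f0 x"
      using mult_left_mono[OF lmean_le f0_nonneg] by (simp add: mult.commute)
    finally show ?thesis by simp
  qed
  have \<eta>_Lp: "\<eta> \<in> Lp_space vol p"
    by (rule Lp_space_bound[OF _ \<phi> \<eta>_bound]) (use C in auto)
  then show "(\<lambda>x. \<phi> x - f0 x * lmean \<phi> x) \<in> Lp_space vol p" by (simp add: \<eta>_def[abs_def])
  define f where "f n x = max 0 (f0 x + 1 / real (Suc n) * \<eta> x)" for n x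
  have [measurable]: "f n \<in> borel_measurable borel" for n unfolding f_def by measurable
  have f_nonneg: "0 \<le> f n x" for n x by (simp add: f_def)
  have "1 \<le> lint (\<lambda>y. ennreal (f n y)) x" for n x
  proof (cases "x \<in> S")
    case True
    let ?\<nu> = "\<mu> (lf x)"
    have int_f0: "integrable ?\<nu> f0"
      using S1[OF True] f0_nonneg by (subst integrable_leaf_iff) auto
    have int_\<phi>: "integrable ?\<nu> \<phi>"
      using SC[OF True] by (subst integrable_leaf_iff) (auto simp: le_less_trans)
    have "ennreal (\<integral>y. f0 y \<partial>?\<nu>) = 1"
      using S1[OF True] nn_integral_eq_integral[OF int_f0] f0_nonneg by (simp add: lint_def)
    then have f0_1: "(\<integral>y. f0 y \<partial>?\<nu>) = 1" by (simp add: ennreal_eq_1)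
    have int_c: "integrable ?\<nu> (\<lambda>y. f0 y + 1 / real (Suc n) * (\<phi> y - f0 y * lmean \<phi> x))"
      using int_f0 int_\<phi> by simp
    \<comment> \<open>On one leaf \<open>lmean \<phi>\<close> is a constant, so the fluctuation is a
      linear combination of \<phi> and \<open>f0\<close> there. Its integral is
      \<open>lmean \<phi> x - lmean \<phi> x * 1 = 0\<close>.\<close>
    have f_eq: "f n y = max 0 (f0 y + 1 / real (Suc n) * (\<phi> y - f0 y * lmean \<phi> x))"
      if "y \<in> lf x" for y
      using saturatedD[OF saturated_lmean that] by (simp add: f_def \<eta>_def)
    have "1 = (\<integral>y. f0 y + 1 / real (Suc n) * (\<phi> y - f0 y * lmean \<phi> x) \<partial>?\<nu>)"
      using int_f0 int_\<phi> by (simp add: f0_1 lmean_def)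
    also have "\<dots> \<le> (\<integral>y. max 0 (f0 y + 1 / real (Suc n) * (\<phi> y - f0 y * lmean \<phi> x)) \<partial>?\<nu>)"
      using int_c by (intro integral_mono integrable_max) auto
    finally have "1 \<le> ennreal (\<integral>y. max 0 (f0 y + 1 / real (Suc n) * (\<phi> y - f0 y * lmean \<phi> x)) \<partial>?\<nu>)"
      by (simp flip: ennreal_1 add: ennreal_le_iff2)
    also have "\<dots> = lint (\<lambda>y. ennreal (max 0 (f0 y + 1 / real (Suc n) * (\<phi> y - f0 y * lmean \<phi> x)))) x"
      unfolding lint_def using int_c by (intro nn_integral_eq_integral[symmetric] integrable_max) auto
    also have "\<dots> = lint (\<lambda>y. ennreal (f n y)) x"
      by (rule lint_cong) (simp add: f_eq)
    finally show ?thesis .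
  next
    case False
    have "f n y = f0 y" if y: "y \<in> lf x" for y
    proof -
      have "lmean \<phi> y = 0" using saturatedD[OF saturated_lmean y, of \<phi>] lmean_off[OF False] by simp
      then show ?thesis using off_leaf[OF False y] f0_nonneg by (simp add: f_def \<eta>_def)
    qed
    then have "lint (\<lambda>y. ennreal (f n y)) x = lint (\<lambda>y. ennreal (f0 y)) x" by (intro lint_cong) simp
    then show ?thesis using lint_f0_ge by simp
  qed
  then have adm: "admissible (range lf) \<mu> (f n)" for n
    using f_nonneg by (auto simp: admissible_def lint_def)
  have f_Lp: "f n \<in> Lp_space vol p" for n
  proof (rule Lp_space_bound[OF _ \<eta>_Lp, of _ 1 1])
    fix x
    have "\<bar>1 / real (Suc n) * \<eta> x\<bar> \<le> \<bar>\<eta> x\<bar>"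
      unfolding abs_mult by (rule mult_left_le_one_le) auto
    then show "\<bar>f n x\<bar> \<le> 1 * \<bar>\<eta> x\<bar> + 1 * f0 x"
      using f0_nonneg[of x] unfolding f_def by linarith
  qed auto
  \<comment> \<open>This is the weight \<open>f0 powr (p - 1)\<close> times the difference quotient
    of \<open>f n\<close> at step \<open>1 / Suc n\<close>. Division by the step turns the positive
    part into a truncation of \<eta> from below at \<open>- Suc n * f0\<close>, a level that recedes
    to minus infinity where \<open>f0\<close> is positive.\<close>
  let ?h = "\<lambda>n x. f0 x powr (p - 1) * max (\<eta> x) (- (real (Suc n) * f0 x))"
  have pos: "0 \<le> (\<integral>x. ?h n x \<partial>vol)" for n
  proof -
    have "max 0 (a + 1 / r * b) - a = 1 / r * max b (- (r * a))" if "r > 0" for a b r :: real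
    proof (cases "0 \<le> a + 1 / r * b")
      case True
      with that have "- (r * a) \<le> b" by (simp add: field_simps)
      with True show ?thesis by simp
    next
      case False
      with that have "b \<le> - (r * a)" by (simp add: field_simps)
      with False that show ?thesis by simp
    qed
    then have "f n x - f0 x = 1 / real (Suc n) * max (\<eta> x) (- (real (Suc n) * f0 x))" for x
      by (simp only: f_def of_nat_0_less_iff zero_less_Suc)
    then have "0 \<le> (\<integral>x. 1 / real (Suc n) * ?h n x \<partial>vol)"
      using first_variation[OF adm f_Lp, of n] by (simp add: mult_ac)
    then show ?thesis by (simp add: zero_le_divide_iff)
  qed
  have "(\<lambda>n. \<integral>x. ?h n x \<partial>vol) \<longlonglongrightarrow> (\<integral>x. f0 x powr (p - 1) * \<eta> x \<partial>vol)"
  proof (rule integral_dominated_convergence)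
    show "integrable vol (\<lambda>x. \<bar>f0 x powr (p - 1) * \<eta> x\<bar>)"
      by (rule integrable_abs[OF integrable_f0_powr_times[OF \<eta>_Lp]])
    show "AE x in vol. norm (?h n x) \<le> \<bar>f0 x powr (p - 1) * \<eta> x\<bar>" for n
    proof (intro AE_I2)
      fix x
      have "0 \<le> real (Suc n) * f0 x" using f0_nonneg by simp
      then have "\<bar>max (\<eta> x) (- (real (Suc n) * f0 x))\<bar> \<le> \<bar>\<eta> x\<bar>" by linarith
      then show "norm (?h n x) \<le> \<bar>f0 x powr (p - 1) * \<eta> x\<bar>"
        by (simp add: abs_mult mult_left_mono)
    qed
    show "AE x in vol. (\<lambda>n. ?h n x) \<longlonglongrightarrow> f0 x powr (p - 1) * \<eta> x"
    proof (intro AE_I2)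
      fix x
      show "(\<lambda>n. ?h n x) \<longlonglongrightarrow> f0 x powr (p - 1) * \<eta> x"
      \<comment> \<open>Where \<open>f0\<close> is 0 the truncation never disappears, but there the
        weight \<open>f0 powr (p - 1)\<close> is 0. Elsewhere the sequence is eventually
        constant.\<close>
      proof (cases "f0 x = 0")
        case False
        then have "f0 x > 0" using f0_nonneg[of x] by simp
        obtain N :: nat where N: "- \<eta> x / f0 x < real N" using reals_Archimedean2 by blast
        have "?h n x = f0 x powr (p - 1) * \<eta> x" if "n \<ge> N" for n
        proof -
          have "- \<eta> x / f0 x < real (Suc n)" using N that by linarith
          then have "- \<eta> x < real (Suc n) * f0 x" using \<open>f0 x > 0\<close> by (simp add: field_simps)
          then show ?thesis by (simp add: max_def)
        qed
        then show ?thesis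
          by (intro tendsto_eventually) (auto simp: eventually_sequentially)
      qed simp
    qed
  qed measurable
  from LIMSEQ_le_const[OF this, of 0]
  have "0 \<le> (\<integral>x. f0 x powr (p - 1) * \<eta> x \<partial>vol)" using pos by blast
  then show "0 \<le> (\<integral>x. f0 x powr (p - 1) * (\<phi> x - f0 x * lmean \<phi> x) \<partial>vol)" by (simp add: \<eta>_def)
qed

section \<open>The identity for Borel functions\<close>

lemma f0_powr_mult_f0: "f0 x powr (p - 1) * (f0 x * r) = f0 x powr p * r"
  using powr_mult_base[OF f0_nonneg, of x "p - 1"] by (simp add: mult_ac)

text \<open>The fluctuation is linear in \<phi>, so the inequalities for \<phi> and its negative
  force its weighted integral to be 0; splitting that integral is the claim. The bound
  \<open>C\<close> keeps \<open>lmean \<phi>\<close> bounded, so that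
  \<open>f0 * lmean \<phi>\<close> stays in L^p.\<close>

lemma leafwise_identity_bounded:
  assumes \<phi>: "\<phi> \<in> Lp_space vol p"
    and sat: "saturated (\<lambda>x. x \<in> S)"
    and S1: "\<And>x. x \<in> S \<Longrightarrow> lint (\<lambda>y. ennreal (f0 y)) x = 1"
    and SC: "\<And>x. x \<in> S \<Longrightarrow> lint (\<lambda>y. ennreal \<bar>\<phi> y\<bar>) x \<le> ennreal C" and C: "C \<ge> 0"
    and off: "\<And>x. x \<notin> S \<Longrightarrow> \<phi> x = 0"
  shows "(\<integral>x. f0 x powr (p - 1) * \<phi> x \<partial>vol) = (\<integral>x. f0 x powr p * lmean \<phi> x \<partial>vol)"
proof -
  note [measurable] = Lp_spaceD[OF \<phi>]
  let ?\<eta> = "\<lambda>x. \<phi> x - f0 x * lmean \<phi> x"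
  have neg: "(\<lambda>x. - \<phi> x) \<in> Lp_space vol p"
    by (rule Lp_space_bound[OF _ \<phi>, of _ 1 0]) auto
  have lmean_neg: "lmean (\<lambda>x. - \<phi> x) = (\<lambda>x. - lmean \<phi> x)" by (simp add: lmean_def fun_eq_iff)
  note pos = integral_fluctuation_nonneg[OF \<phi> sat S1 SC C off]
  have "0 \<le> (\<integral>x. f0 x powr (p - 1) * (- \<phi> x - f0 x * lmean (\<lambda>x. - \<phi> x) x) \<partial>vol)"
    by (rule integral_fluctuation_nonneg(2)[OF neg sat S1 _ C]) (use SC off in auto)
  also have "(\<lambda>x. f0 x powr (p - 1) * (- \<phi> x - f0 x * lmean (\<lambda>x. - \<phi> x) x)) =
      (\<lambda>x. - (f0 x powr (p - 1) * ?\<eta> x))"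
    by (simp add: lmean_neg fun_eq_iff algebra_simps)
  finally have "(\<integral>x. f0 x powr (p - 1) * ?\<eta> x \<partial>vol) = 0" using pos(2) by simp
  moreover have "(\<integral>x. f0 x powr (p - 1) * \<phi> x \<partial>vol) - (\<integral>x. f0 x powr (p - 1) * ?\<eta> x \<partial>vol) =
      (\<integral>x. f0 x powr p * lmean \<phi> x \<partial>vol)"
  proof (subst Bochner_Integration.integral_diff[symmetric])
    show "(\<integral>x. f0 x powr (p - 1) * \<phi> x - f0 x powr (p - 1) * ?\<eta> x \<partial>vol) =
        (\<integral>x. f0 x powr p * lmean \<phi> x \<partial>vol)"
      by (simp add: f0_powr_mult_f0 flip: right_diff_distrib)
  qed (intro integrable_f0_powr_times \<phi> pos(1))+
  ultimately show ?thesis by simp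
qed

text \<open>Truncating \<xi> to Borel unions of leaves brings \<open>\<xi> * \<phi>\<close> into the
  bounded case, and a multiplier constant on leaves commutes with \<open>lmean\<close>. The
  truncations exhaust almost all points with \<open>f0 x \<noteq> 0\<close>, and the bounds
  \<open>B\<close> and \<open>K\<close> at such points provide the dominating functions.\<close>

theorem leafwise_identity:
  assumes \<phi>: "\<phi> \<in> Lp_space vol p"
    and B: "AE x in vol. f0 x \<noteq> 0 \<longrightarrow> \<bar>lmean \<phi> x\<bar> \<le> B"
    and \<xi> [measurable]: "\<xi> \<in> borel_measurable borel" and sat: "saturated \<xi>"
    and K: "AE x in vol. f0 x \<noteq> 0 \<longrightarrow> \<bar>\<xi> x\<bar> \<le> K"
  shows "integrable vol (\<lambda>x. f0 x powr (p - 1) * \<phi> x * \<xi> x)"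
    and "integrable vol (\<lambda>x. f0 x powr p * lmean \<phi> x * \<xi> x)"
    and "(\<integral>x. f0 x powr (p - 1) * \<phi> x * \<xi> x \<partial>vol) = (\<integral>x. f0 x powr p * lmean \<phi> x * \<xi> x \<partial>vol)"
proof -
  note [measurable] = Lp_spaceD[OF \<phi>]
  have dom1: "integrable vol (\<lambda>x. K * \<bar>f0 x powr (p - 1) * \<phi> x\<bar>)"
    using integrable_f0_powr_times[OF \<phi>] by simp
  have dom2: "integrable vol (\<lambda>x. f0 x powr p * (B * K))"
    using integrable_f0_powr by simp
  have bound1: "AE x in vol. \<bar>f0 x powr (p - 1) * \<phi> x * \<xi> x\<bar> \<le> K * \<bar>f0 x powr (p - 1) * \<phi> x\<bar>"
    using K
  proof eventually_elim
    case (elim x)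
    then show ?case
      by (cases "f0 x = 0") (auto simp: abs_mult mult.commute[of K] intro!: mult_left_mono)
  qed
  have bound2: "AE x in vol. \<bar>f0 x powr p * lmean \<phi> x * \<xi> x\<bar> \<le> f0 x powr p * (B * K)"
    using K B
  proof eventually_elim
    case (elim x)
    then show ?case
      by (cases "f0 x = 0") (auto simp: abs_mult mult.assoc intro!: mult_left_mono mult_mono)
  qed
  show int1: "integrable vol (\<lambda>x. f0 x powr (p - 1) * \<phi> x * \<xi> x)"
    using bound1 by (intro Bochner_Integration.integrable_bound[OF dom1]) (measurable, auto)
  show int2: "integrable vol (\<lambda>x. f0 x powr p * lmean \<phi> x * \<xi> x)"
    using bound2 by (intro Bochner_Integration.integrable_bound[OF dom2]) (measurable, auto)

  \<comment> \<open>Each condition is constant on leaves. They normalize \<open>f0\<close>, bound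
    the leafwise norm of \<phi> and bound the multiplier. Almost everywhere where \<open>f0\<close>
    does not vanish they hold for all large \<open>n\<close>, as the two bounded quantities are
    finite there.\<close>
  define S where "S n = {x. lint (\<lambda>y. ennreal (f0 y)) x = 1 \<and>
    lint (\<lambda>y. ennreal \<bar>\<phi> y\<bar>) x \<le> ennreal (real n) \<and> \<bar>\<xi> x\<bar> \<le> real n}" for n
  have [measurable]: "S n \<in> sets borel" for n unfolding S_def by measurable
  have S_sat: "saturated (\<lambda>x. x \<in> S n)" for n
    using sat saturated_lint[of "\<lambda>y. ennreal (f0 y)"] saturated_lint[of "\<lambda>y. ennreal \<bar>\<phi> y\<bar>"]
    by (simp add: S_def saturated_def)
  define \<zeta> where "\<zeta> n x = indicator (S n) x * \<xi> x" for n x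
  have [measurable]: "\<zeta> n \<in> borel_measurable borel" for n unfolding \<zeta>_def by measurable
  have \<zeta>_sat: "saturated (\<zeta> n)" for n
    using sat S_sat[of n] by (simp add: \<zeta>_def saturated_def indicator_def)
  have \<zeta>_le: "\<bar>\<zeta> n x\<bar> \<le> real n" for n x by (auto simp: \<zeta>_def indicator_def S_def)
  have eq: "(\<integral>x. f0 x powr (p - 1) * (\<zeta> n x * \<phi> x) \<partial>vol) =
      (\<integral>x. f0 x powr p * (\<zeta> n x * lmean \<phi> x) \<partial>vol)" for n
    \<comment> \<open>Moving the multiplier back inside \<open>lmean\<close> makes this the bounded
      identity for \<open>\<zeta> n * \<phi>\<close>. The constant \<open>real n * real n\<close> is
      the bound of \<open>\<zeta> n\<close> times the bound of the leafwise integral of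
      \<bar>\<phi>\<bar> on \<open>S n\<close>.\<close>
    unfolding lmean_cmult_saturated[OF \<zeta>_sat, symmetric]
  proof (rule leafwise_identity_bounded[where S = "S n" and C = "real n * real n"])
    have "\<bar>\<zeta> n x * \<phi> x\<bar> \<le> real n * \<bar>\<phi> x\<bar> + 0 * f0 x" for x
      unfolding abs_mult using \<zeta>_le by (simp add: mult_right_mono)
    from Lp_space_bound[OF _ \<phi> this] show "(\<lambda>x. \<zeta> n x * \<phi> x) \<in> Lp_space vol p" by simp
    fix x assume x: "x \<in> S n"
    show "lint (\<lambda>y. ennreal (f0 y)) x = 1" using x by (simp add: S_def)
    have "lint (\<lambda>y. ennreal \<bar>\<zeta> n y * \<phi> y\<bar>) x \<le> lint (\<lambda>y. ennreal (real n) * ennreal \<bar>\<phi> y\<bar>) x"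
    proof (rule lint_mono)
      fix y
      show "ennreal \<bar>\<zeta> n y * \<phi> y\<bar> \<le> ennreal (real n) * ennreal \<bar>\<phi> y\<bar>"
        unfolding abs_mult using \<zeta>_le[of n y]
        by (simp add: ennreal_mult mult_right_mono ennreal_leI)
    qed
    also have "\<dots> = ennreal (real n) * lint (\<lambda>y. ennreal \<bar>\<phi> y\<bar>) x"
      by (rule lint_cmult) measurable
    also have "\<dots> \<le> ennreal (real n) * ennreal (real n)"
      using x by (intro mult_left_mono) (auto simp: S_def)
    also have "\<dots> = ennreal (real n * real n)" by (simp flip: ennreal_mult)
    finally show "lint (\<lambda>y. ennreal \<bar>\<zeta> n y * \<phi> y\<bar>) x \<le> ennreal (real n * real n)" .
  qed (auto simp: S_sat \<zeta>_def)

  have in_S: "AE x in vol. f0 x \<noteq> 0 \<longrightarrow> eventually (\<lambda>n. x \<in> S n) sequentially"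
  proof -
    have "(\<integral>\<^sup>+ x. ennreal (\<bar>\<phi> x\<bar> powr p) \<partial>vol) < \<infinity>"
      using Lp_space_integrable[OF \<phi>] by (simp add: integrable_iff_bounded)
    from lint_f0_eq_1 lint_finite[OF _ this, simplified] show ?thesis
    proof eventually_elim
      case (elim x)
      show ?case
      proof
        assume "f0 x \<noteq> 0"
        with elim have *: "lint (\<lambda>y. ennreal (f0 y)) x = 1" "lint (\<lambda>y. ennreal \<bar>\<phi> y\<bar>) x < \<infinity>"
          by auto
        then obtain c where c: "lint (\<lambda>y. ennreal \<bar>\<phi> y\<bar>) x = ennreal c" "c \<ge> 0"
          by (cases "lint (\<lambda>y. ennreal \<bar>\<phi> y\<bar>) x") auto
        obtain N :: nat where "max c \<bar>\<xi> x\<bar> \<le> real N" using real_arch_simple by blast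
        then have "x \<in> S n" if "n \<ge> N" for n
          using that * c by (auto simp: S_def intro!: ennreal_leI)
        then show "eventually (\<lambda>n. x \<in> S n) sequentially"
          by (auto simp: eventually_sequentially)
      qed
    qed
  qed
  have \<zeta>_abs: "\<bar>\<zeta> n x\<bar> \<le> \<bar>\<xi> x\<bar>" for n x by (simp add: \<zeta>_def indicator_def)
  have lim: "AE x in vol. f0 x \<noteq> 0 \<longrightarrow> (\<lambda>n. \<zeta> n x) \<longlonglongrightarrow> \<xi> x"
    using in_S
    by eventually_elim (auto simp: \<zeta>_def elim!: eventually_mono intro!: tendsto_eventually)
  have "(\<lambda>n. \<integral>x. f0 x powr (p - 1) * (\<zeta> n x * \<phi> x) \<partial>vol) \<longlonglongrightarrow>
      (\<integral>x. f0 x powr (p - 1) * \<phi> x * \<xi> x \<partial>vol)"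
  proof (rule integral_dominated_convergence[where w = "\<lambda>x. \<bar>f0 x powr (p - 1) * \<phi> x * \<xi> x\<bar>"])
    show "AE x in vol. (\<lambda>n. f0 x powr (p - 1) * (\<zeta> n x * \<phi> x)) \<longlonglongrightarrow> f0 x powr (p - 1) * \<phi> x * \<xi> x"
      using lim
    proof eventually_elim
      case (elim x)
      show ?case
      proof (cases "f0 x = 0")
        case False
        with elim have "(\<lambda>n. f0 x powr (p - 1) * (\<zeta> n x * \<phi> x)) \<longlonglongrightarrow> f0 x powr (p - 1) * (\<xi> x * \<phi> x)"
          by (intro tendsto_intros) simp
        then show ?thesis by (simp add: mult_ac)
      qed simp
    qed
    show "AE x in vol. norm (f0 x powr (p - 1) * (\<zeta> n x * \<phi> x)) \<le> \<bar>f0 x powr (p - 1) * \<phi> x * \<xi> x\<bar>" for n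
      using \<zeta>_abs by (intro AE_I2) (simp add: abs_mult mult_ac mult_left_mono mult_right_mono)
  qed (use int1 in simp_all)
  moreover have "(\<lambda>n. \<integral>x. f0 x powr p * (\<zeta> n x * lmean \<phi> x) \<partial>vol) \<longlonglongrightarrow>
      (\<integral>x. f0 x powr p * lmean \<phi> x * \<xi> x \<partial>vol)"
  proof (rule integral_dominated_convergence[where w = "\<lambda>x. \<bar>f0 x powr p * lmean \<phi> x * \<xi> x\<bar>"])
    show "AE x in vol. (\<lambda>n. f0 x powr p * (\<zeta> n x * lmean \<phi> x)) \<longlonglongrightarrow> f0 x powr p * lmean \<phi> x * \<xi> x"
      using lim
    proof eventually_elim
      case (elim x)
      show ?case
      proof (cases "f0 x = 0")
        case False
        with elim have "(\<lambda>n. f0 x powr p * (\<zeta> n x * lmean \<phi> x)) \<longlonglongrightarrow> f0 x powr p * (\<xi> x * lmean \<phi> x)"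
          by (intro tendsto_intros) simp
        then show ?thesis by (simp add: mult_ac)
      qed simp
    qed
    show "AE x in vol. norm (f0 x powr p * (\<zeta> n x * lmean \<phi> x)) \<le> \<bar>f0 x powr p * lmean \<phi> x * \<xi> x\<bar>" for n
      using \<zeta>_abs by (intro AE_I2) (simp add: abs_mult mult_ac mult_left_mono mult_right_mono)
  qed (use int2 in simp_all)
  ultimately show "(\<integral>x. f0 x powr (p - 1) * \<phi> x * \<xi> x \<partial>vol) = (\<integral>x. f0 x powr p * lmean \<phi> x * \<xi> x \<partial>vol)"
    unfolding eq by (rule LIMSEQ_unique)
qed

section \<open>Passage to Lebesgue measurable functions\<close>

lemma Lp_foliation_borel:
  assumes "\<phi> \<in> Lp_foliation lf vol \<mu> p"
  obtains \<phi>' B where "\<phi>' \<in> Lp_space vol p" "AE x in vol. \<phi> x = \<phi>' x"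
    "AE x in vol. f0 x \<noteq> 0 \<longrightarrow> hat lf \<mu> \<phi> x = lmean \<phi>' x"
    "AE x in vol. f0 x \<noteq> 0 \<longrightarrow> \<bar>lmean \<phi>' x\<bar> \<le> B"
proof -
  have \<phi>: "\<phi> \<in> borel_measurable (completion vol)"
    "integrable (completion vol) (\<lambda>x. \<bar>\<phi> x\<bar> powr p)"
    and ess: "esssup (completion vol) (\<lambda>x. ereal \<bar>hat lf \<mu> \<phi> x\<bar>) < \<infinity>"
    using assms by (auto simp: Lp_foliation_def Lp_space_def)
  obtain \<phi>' where \<phi>': "\<phi>' \<in> borel_measurable vol" and eq: "AE x in vol. \<phi> x = \<phi>' x"
    using completion_ex_borel_measurable_real[OF \<phi>(1)] by blast
  have [measurable]: "\<phi>' \<in> borel_measurable borel" using \<phi>' by (simp add: borel_measurable_vol)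
  have "AE x in completion vol. \<bar>\<phi> x\<bar> powr p = \<bar>\<phi>' x\<bar> powr p"
    using AE_completion[OF eq] by eventually_elim simp
  from integrable_cong_AE_imp[OF \<phi>(2) _ this]
  have "integrable (completion vol) (\<lambda>x. \<bar>\<phi>' x\<bar> powr p)"
    using \<phi>' by (simp add: measurable_completion)
  then have Lp: "\<phi>' \<in> Lp_space vol p"
    using \<phi>' by (subst (asm) integrable_completion) (auto simp: Lp_space_def)
  \<comment> \<open>Changing \<phi> on a null set of the manifold could alter its leafwise
    integrals. Minimality excludes this for almost every point where \<open>f0\<close> does not
    vanish, since the leaf through such a point meets \<open>N\<close> in a null set.\<close>
  obtain N where N: "N \<in> null_sets vol" "{x. \<phi> x \<noteq> \<phi>' x} \<subseteq> N"
    using eq by (auto simp: eventually_ae_filter space_vol)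
  have hat_eq: "AE x in vol. f0 x \<noteq> 0 \<longrightarrow> hat lf \<mu> \<phi> x = lmean \<phi>' x"
    using null_set_on_leaves[OF N(1)]
  proof eventually_elim
    case (elim x)
    show ?case
    proof
      assume "f0 x \<noteq> 0"
      with elim have "AE y in \<mu> (lf x). y \<notin> N" by simp
      then have "AE y in \<mu> (lf x). \<phi> y = \<phi>' y"
        by eventually_elim (use N(2) in auto)
      from completion_integral_AE(1)[OF _ this] show "hat lf \<mu> \<phi> x = lmean \<phi>' x"
        by (simp add: hat_def lmean_def measurable_leaf)
    qed
  qed
  obtain B :: nat where B: "esssup (completion vol) (\<lambda>x. ereal \<bar>hat lf \<mu> \<phi> x\<bar>) < ereal (real B)"
    using ess less_PInf_Ex_of_nat by fastforce
  have "AE x in completion vol. ereal \<bar>hat lf \<mu> \<phi> x\<bar> \<le> esssup (completion vol) (\<lambda>x. ereal \<bar>hat lf \<mu> \<phi> x\<bar>)"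
    by (rule esssup_AE)
  then have "AE x in completion vol. \<bar>hat lf \<mu> \<phi> x\<bar> \<le> real B"
  proof eventually_elim
    case (elim x)
    with B have "ereal \<bar>hat lf \<mu> \<phi> x\<bar> < ereal (real B)" by (rule le_less_trans[rotated])
    then show ?case by simp
  qed
  then have "AE x in vol. \<bar>hat lf \<mu> \<phi> x\<bar> \<le> real B" by (simp add: AE_completion_iff)
  with hat_eq have "AE x in vol. f0 x \<noteq> 0 \<longrightarrow> \<bar>lmean \<phi>' x\<bar> \<le> real B"
    by eventually_elim auto
  with Lp eq hat_eq show thesis by (rule that)
qed

text \<open>The Borel identity is applied with multiplier \<open>lmean \<psi>'\<close> for the
  pairing and with multiplier 1 for the special case. The latter corresponds to \<psi> =
  \<open>f0\<close>, whose leafwise integral is 1 almost everywhere where \<open>f0\<close> does not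
  vanish.\<close>

lemma hat_pairing:
  assumes \<phi>: "\<phi> \<in> Lp_foliation lf vol \<mu> p" and \<psi>: "\<psi> \<in> Lp_foliation lf vol \<mu> p"
  defines "M \<equiv> completion vol" and "h \<equiv> hat lf \<mu>"
  shows "integrable M (\<lambda>x. f0 x powr (p - 1) * \<phi> x * h \<psi> x)"
    and "integrable M (\<lambda>x. f0 x powr p * h \<phi> x * h \<psi> x)"
    and "(\<integral>x. f0 x powr (p - 1) * \<phi> x * h \<psi> x \<partial>M) = (\<integral>x. f0 x powr p * h \<phi> x * h \<psi> x \<partial>M)"
    and "integrable M (\<lambda>x. f0 x powr (p - 1) * \<phi> x)"
    and "integrable M (\<lambda>x. f0 x powr p * h \<phi> x)"
    and "(\<integral>x. f0 x powr (p - 1) * \<phi> x \<partial>M) = (\<integral>x. f0 x powr p * h \<phi> x \<partial>M)"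
proof -
  obtain \<phi>' B where \<phi>': "\<phi>' \<in> Lp_space vol p" "AE x in vol. \<phi> x = \<phi>' x"
    "AE x in vol. f0 x \<noteq> 0 \<longrightarrow> hat lf \<mu> \<phi> x = lmean \<phi>' x"
    "AE x in vol. f0 x \<noteq> 0 \<longrightarrow> \<bar>lmean \<phi>' x\<bar> \<le> B"
    using Lp_foliation_borel[OF \<phi>] .
  obtain \<psi>' K where \<psi>': "\<psi>' \<in> Lp_space vol p" "AE x in vol. \<psi> x = \<psi>' x"
    "AE x in vol. f0 x \<noteq> 0 \<longrightarrow> hat lf \<mu> \<psi> x = lmean \<psi>' x"
    "AE x in vol. f0 x \<noteq> 0 \<longrightarrow> \<bar>lmean \<psi>' x\<bar> \<le> K"
    using Lp_foliation_borel[OF \<psi>] .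
  note [measurable] = Lp_spaceD[OF \<phi>'(1)] Lp_spaceD[OF \<psi>'(1)]
  have "AE x in vol. f0 x powr (p - 1) * \<phi> x * h \<psi> x = f0 x powr (p - 1) * \<phi>' x * lmean \<psi>' x"
    using \<phi>'(2) \<psi>'(3) by eventually_elim (auto simp: h_def)
  note 1 = completion_integral_AE[OF _ this, folded M_def]
  have "AE x in vol. f0 x powr p * h \<phi> x * h \<psi> x = f0 x powr p * lmean \<phi>' x * lmean \<psi>' x"
    using \<phi>'(3) \<psi>'(3) by eventually_elim (auto simp: h_def)
  note 2 = completion_integral_AE[OF _ this, folded M_def]
  have "AE x in vol. f0 x powr (p - 1) * \<phi> x = f0 x powr (p - 1) * \<phi>' x * 1"
    using \<phi>'(2) by eventually_elim auto
  note 3 = completion_integral_AE[OF _ this, folded M_def]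
  have "AE x in vol. f0 x powr p * h \<phi> x = f0 x powr p * lmean \<phi>' x * 1"
    using \<phi>'(3) by eventually_elim (auto simp: h_def)
  note 4 = completion_integral_AE[OF _ this, folded M_def]
  note id = leafwise_identity[OF \<phi>'(1,4) _ saturated_lmean \<psi>'(4), simplified]
  have "saturated (\<lambda>_. 1::real)" by (simp add: saturated_def)
  note id1 = leafwise_identity[OF \<phi>'(1,4) _ this, of 1]
  show "integrable M (\<lambda>x. f0 x powr (p - 1) * \<phi> x * h \<psi> x)"
    by (rule 1) (use id in simp_all)
  show "integrable M (\<lambda>x. f0 x powr p * h \<phi> x * h \<psi> x)"
    by (rule 2) (use id in simp_all)
  show "(\<integral>x. f0 x powr (p - 1) * \<phi> x * h \<psi> x \<partial>M) = (\<integral>x. f0 x powr p * h \<phi> x * h \<psi> x \<partial>M)"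
    using id by (simp add: 1 2)
  show "integrable M (\<lambda>x. f0 x powr (p - 1) * \<phi> x)"
    by (rule 3) (use id1 in simp_all)
  show "integrable M (\<lambda>x. f0 x powr p * h \<phi> x)"
    by (rule 4) (use id1 in simp_all)
  show "(\<integral>x. f0 x powr (p - 1) * \<phi> x \<partial>M) = (\<integral>x. f0 x powr p * h \<phi> x \<partial>M)"
    using id1 by (simp add: 3 4)
qed

end

theorem proposition2p3:
  fixes A F :: "('m::{second_countable_topology, t2_space}, 'e::euclidean_space) chart set"
    and D :: "'e set"
    and g :: "('m, 'e) chart \<Rightarrow> 'e \<Rightarrow> 'e \<Rightarrow> 'e \<Rightarrow> real"
    and vol :: "'m measure" and \<mu> :: "'m set \<Rightarrow> 'm measure"
    and p :: real and f0 :: "'m \<Rightarrow> real"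
  assumes "smooth_atlas A" and "riemannian_metric A g" and "foliation A D F"
    and "riemannian_measure A g vol"
    and "\<And>L. L \<in> leaves D F \<Longrightarrow> leaf_riemannian_measure D F g L (\<mu> L)"
    and "p > 1"
    and "extremal (leaves D F) vol \<mu> p f0"
  shows "let h = hat (leaf D F) \<mu>; M = completion vol; LpF = Lp_foliation (leaf D F) vol \<mu> p in
    (\<forall>\<phi>\<in>LpF. \<forall>\<psi>\<in>LpF.
      integrable M (\<lambda>x. f0 x powr (p - 1) * \<phi> x * h \<psi> x) \<and>
      integrable M (\<lambda>x. f0 x powr (p - 1) * h \<phi> x * \<psi> x) \<and>
      integrable M (\<lambda>x. f0 x powr p * h \<phi> x * h \<psi> x) \<and>
      (\<integral>x. f0 x powr (p - 1) * \<phi> x * h \<psi> x \<partial>M) = (\<integral>x. f0 x powr (p - 1) * h \<phi> x * \<psi> x \<partial>M) \<and>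
      (\<integral>x. f0 x powr (p - 1) * h \<phi> x * \<psi> x \<partial>M) = (\<integral>x. f0 x powr p * h \<phi> x * h \<psi> x \<partial>M)) \<and>
    (\<forall>\<phi>\<in>LpF.
      integrable M (\<lambda>x. f0 x powr (p - 1) * \<phi> x) \<and>
      integrable M (\<lambda>x. f0 x powr p * h \<phi> x) \<and>
      (\<integral>x. f0 x powr (p - 1) * \<phi> x \<partial>M) = (\<integral>x. f0 x powr p * h \<phi> x \<partial>M))"
proof -
  obtain C Q where "metric_flow_boxes F D C Q g \<mu>"
    using obtain_metric_flow_boxes[OF assms(1-3,5)] by blast
  then interpret B: metric_flow_boxes F D C Q g \<mu> .
  interpret extremal_leafwise vol "leaf D F" \<mu> p f0
  proof
    show "sets vol = sets borel" using assms(4) by (simp add: riemannian_measure_def)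
    show "leaf D F y = leaf D F x" if "y \<in> leaf D F x" for x y using that by (rule leaf_eq)
    show "extremal (range (leaf D F)) vol \<mu> p f0" using assms(7) by (simp add: leaves_def)
  qed (fact B.space_leaf_measure B.sets_leaf_measure B.borel_nn_integral_leaf assms(6))+
  show ?thesis
    unfolding Let_def
  proof (intro conjI ballI)
    let ?h = "hat (leaf D F) \<mu>" and ?M = "completion vol"
    fix \<phi> assume \<phi>: "\<phi> \<in> Lp_foliation (leaf D F) vol \<mu> p"
    note 1 = hat_pairing[OF \<phi> \<phi>]
    show "integrable ?M (\<lambda>x. f0 x powr (p - 1) * \<phi> x)" by (rule 1(4))
    show "integrable ?M (\<lambda>x. f0 x powr p * ?h \<phi> x)" by (rule 1(5))
    show "(\<integral>x. f0 x powr (p - 1) * \<phi> x \<partial>?M) = (\<integral>x. f0 x powr p * ?h \<phi> x \<partial>?M)" by (rule 1(6))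
    fix \<psi> assume \<psi>: "\<psi> \<in> Lp_foliation (leaf D F) vol \<mu> p"
    \<comment> \<open>Exchanging \<phi> and \<psi> leaves the integral of
      \<open>f0 powr p * h \<phi> * h \<psi>\<close> unchanged, so both mixed integrals equal
      it.\<close>
    note 2 = hat_pairing[OF \<phi> \<psi>] and 3 = hat_pairing[OF \<psi> \<phi>]
    show "integrable ?M (\<lambda>x. f0 x powr (p - 1) * \<phi> x * ?h \<psi> x)" by (rule 2(1))
    show "integrable ?M (\<lambda>x. f0 x powr (p - 1) * ?h \<phi> x * \<psi> x)" using 3(1) by (simp add: mult_ac)
    show "integrable ?M (\<lambda>x. f0 x powr p * ?h \<phi> x * ?h \<psi> x)" by (rule 2(2))
    show "(\<integral>x. f0 x powr (p - 1) * ?h \<phi> x * \<psi> x \<partial>?M) = (\<integral>x. f0 x powr p * ?h \<phi> x * ?h \<psi> x \<partial>?M)"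
      using 3(3) by (simp add: mult_ac)
    then show "(\<integral>x. f0 x powr (p - 1) * \<phi> x * ?h \<psi> x \<partial>?M) =
        (\<integral>x. f0 x powr (p - 1) * ?h \<phi> x * \<psi> x \<partial>?M)"
      using 2(3) by simp
  qed
qed

end
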